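(* Let $p=p_n$ satisfy $n\geq p+5$ and $\lim_{n\to\infty}p/n=y\in(0,1]$. Let $\mathbf{X}=(\mathbf{y}_1,\dots,\mathbf{y}_p)$ be an $n\times p$ random matrix whose columns $\mathbf{y}_1,\dots,\mathbf{y}_p$ are independent random vectors, each having an $n$-variate spherical distribution (the distributions may differ) with $P(\mathbf{y}_i=\mathbf{0})=0$ for all $i$. Let $\mathbf{R}_n=(r_{ij})_{p\times p}$ with $r_{ij}$ the Pearson correlation coefficient between $\mathbf{y}_i$ and $\mathbf{y}_j$. Then $(\log|\mathbf{R}_n|-\mu_n)/\sigma_n$ converges in distribution to $N(0,1)$ as $n\to\infty$, where $$\mu_n=\Big(p-n+\frac32\Big)\log\Big(1-\frac p{n-1}\Big)-\frac{n-2}{n-1}p,\qquad \sigma_n^2=-2\Big[\frac p{n-1}+\log\Big(1-\frac p{n-1}\Big)\Big].$$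
   Context: A random vector $\mathbf{x}\in\mathbb{R}^n$ has a spherical distribution if $\mathbf{O}\mathbf{x}$ and $\mathbf{x}$ have the same distribution for every $n\times n$ orthogonal matrix $\mathbf O$. For $\mathbf{x}=(x_1,\dots,x_n)',\mathbf{y}=(y_1,\dots,y_n)'\in\mathbb{R}^n$, the Pearson correlation coefficient is $r_{\mathbf x,\mathbf y}=\frac{\sum_{i=1}^n(x_i-\bar x)(y_i-\bar y)}{\sqrt{\sum_{i=1}^n(x_i-\bar x)^2\sum_{i=1}^n(y_i-\bar y)^2}}$ with $\bar x=\frac1n\sum x_i$, $\bar y=\frac1n\sum y_i$. $|\cdot|$ denotes the determinant. *)

theory Defs
  imports "HOL-Probability.Probability" "Jordan_Normal_Form.Determinant"
begin

abbreviation vec_space :: "nat \<Rightarrow> (nat \<Rightarrow> real) measure" where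
  "vec_space n \<equiv> PiM {..<n} (\<lambda>_. borel)"

definition orth_nat :: "nat \<Rightarrow> (nat \<Rightarrow> nat \<Rightarrow> real) \<Rightarrow> bool" where
  "orth_nat n Q \<longleftrightarrow> (\<forall>i<n. \<forall>j<n. (\<Sum>k<n. Q k i * Q k j) = (if i = j then 1 else 0))"

definition mat_app :: "nat \<Rightarrow> (nat \<Rightarrow> nat \<Rightarrow> real) \<Rightarrow> (nat \<Rightarrow> real) \<Rightarrow> (nat \<Rightarrow> real)" where
  "mat_app n Q x = (\<lambda>i\<in>{..<n}. \<Sum>k<n. Q i k * x k)"

definition spherical :: "'a measure \<Rightarrow> nat \<Rightarrow> ('a \<Rightarrow> nat \<Rightarrow> real) \<Rightarrow> bool" where
  "spherical M n X \<longleftrightarrow> X \<in> measurable M (vec_space n) \<and>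
     (\<forall>Q. orth_nat n Q \<longrightarrow>
        distr M (vec_space n) (\<lambda>\<omega>. mat_app n Q (X \<omega>)) = distr M (vec_space n) X)"

definition vmean :: "nat \<Rightarrow> (nat \<Rightarrow> real) \<Rightarrow> real" where
  "vmean n x = (\<Sum>i<n. x i) / real n"

definition pearson :: "nat \<Rightarrow> (nat \<Rightarrow> real) \<Rightarrow> (nat \<Rightarrow> real) \<Rightarrow> real" where
  "pearson n x y =
     (\<Sum>i<n. (x i - vmean n x) * (y i - vmean n y)) /
     sqrt ((\<Sum>i<n. (x i - vmean n x)\<^sup>2) * (\<Sum>i<n. (y i - vmean n y)\<^sup>2))"

definition corr_mat :: "nat \<Rightarrow> nat \<Rightarrow> (nat \<Rightarrow> nat \<Rightarrow> real) \<Rightarrow> real mat" where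
  "corr_mat n p Y = mat p p (\<lambda>(i, j). pearson n (Y i) (Y j))"

definition mu_n :: "nat \<Rightarrow> nat \<Rightarrow> real" where
  "mu_n n p = (real p - real n + 3/2) * ln (1 - real p / (real n - 1))
              - (real n - 2) / (real n - 1) * real p"

definition sigma_sq_n :: "nat \<Rightarrow> nat \<Rightarrow> real" where
  "sigma_sq_n n p = - 2 * (real p / (real n - 1) + ln (1 - real p / (real n - 1)))"

end

theory Submission
  imports Defs "HOL-Real_Asymp.Real_Asymp"
begin

text \<open>
  Put \<open>m = n - 1\<close>. Triangularising \<open>(1, y\<^sub>1, \<dots>, y\<^sub>p)\<close> by reflections writes \<open>|R\<^sub>n|\<close> as a product of
  ratios \<open>U\<^sub>i = \<Sum>\<^sub>l\<^sub>>\<^sub>i (Q y\<^sub>i)\<^sub>l\<^sup>2 / \<Sum>\<^sub>l\<^sub>>\<^sub>0 (Q y\<^sub>i)\<^sub>l\<^sup>2\<close>, where \<open>Q\<close> depends only on the earlier columns;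
  by sphericity and Fubini the characteristic function of \<open>log |R\<^sub>n|\<close> is the product of those of
  \<open>log U\<^sub>i\<close> with \<open>Q\<close> removed. Let \<open>U\<close> be the share of \<open>a\<close> coordinates in the squared length of \<open>d\<close> coordinates
  of a spherical vector. Differentiating the invariance of \<open>x\<^sub>k x\<^sub>l h(U) / |x|\<^sup>2\<close> along planar
  reflections gives the Stein equation \<open>E[(d U - a) h(U) - 2 U (1 - U) h'(U)] = 0\<close> of the Beta law with
  parameters \<open>a/2\<close> and \<open>(d - a)/2\<close>, whose instance \<open>h(U) = U\<^sup>s\<close> is the recurrence
  \<open>(d + 2 s) E U\<^sup>s\<^sup>+\<^sup>1 = (a + 2 s) E U\<^sup>s\<close>. Iterating it along \<open>s = i \<tau> + N\<close> expresses \<open>E U\<^sup>i\<^sup>\<tau>\<close> as an infinite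
  product, and a second-order expansion of its factors telescopes, first in \<open>N\<close> and then over the
  columns, to \<open>exp (i \<tau> \<mu>\<^sub>n - \<tau>\<^sup>2 \<sigma>\<^sub>n\<^sup>2 / 2)\<close> up to a relative error of order
  \<open>(|\<tau>| + \<tau>\<^sup>2 + |\<tau>|\<^sup>3) / (m - p)\<close>, which vanishes for \<open>\<tau> = t / \<sigma>\<^sub>n\<close>: either \<open>m - p\<close> or \<open>\<sigma>\<^sub>n\<close> tends to infinity.
\<close>

section \<open>Asymptotics of Beta products\<close>

text \<open>The derivative of the error is \<open>w^2 / (1 + w)\<close>, and \<open>1 + w\<close>
  has modulus at least 1/2 on the disc of radius \<open>norm z\<close>; the mean value inequality on
  that disc does the rest.\<close>

lemma Ln_quadratic_error:
  fixes z :: complex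
  assumes "norm z \<le> 1/2"
  shows "norm (Ln (1 + z) - z + z^2/2) \<le> 2 * norm z ^ 3"
proof -
  define f where "f = (\<lambda>w::complex. Ln (1 + w) - w + w^2/2)"
  define f' where "f' = (\<lambda>w::complex. w^2/(1+w))"
  have ne: "1 + w \<notin> \<real>\<^sub>\<le>\<^sub>0" "1/2 \<le> norm (1 + w)" if "norm w \<le> 1/2" for w :: complex
  proof -
    have "\<bar>Re w\<bar> \<le> 1/2" using that abs_Re_le_cmod order_trans by blast
    then have "Re (1 + w) \<ge> 1/2" by simp
    then show "1 + w \<notin> \<real>\<^sub>\<le>\<^sub>0" by (auto simp: complex_nonpos_Reals_iff)
    show "1/2 \<le> norm (1 + w)" using \<open>Re (1 + w) \<ge> 1/2\<close> complex_Re_le_cmod order_trans by blast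
  qed
  have "norm (f z - f 0) \<le> (2 * norm z^2) * norm (z - 0)"
  proof (rule field_differentiable_bound[where S="cball 0 (norm z)" and f'=f'])
    fix w :: complex assume w: "w \<in> cball 0 (norm z)"
    then have wn: "norm w \<le> norm z" "norm w \<le> 1/2" using assms by auto
    have n0: "1 + w \<noteq> 0" using ne(2)[OF wn(2)] by auto
    have f': "f' w = inverse (1+w) - 1 + w"
      using n0 by (simp add: f'_def field_simps power2_eq_square)
    show "(f has_field_derivative f' w) (at w within cball 0 (norm z))"
      unfolding f_def f' using ne(1)[OF wn(2)] n0
      by (auto intro!: derivative_eq_intros)
    have "norm (f' w) = norm w^2 / norm (1+w)" by (simp add: f'_def norm_divide norm_power)
    also have "\<dots> \<le> norm z^2 / (1/2)"
      by (intro frac_le power_mono wn ne(2)[OF wn(2)]) auto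
    finally show "norm (f' w) \<le> 2 * norm z^2" by simp
  qed auto
  moreover have "f 0 = 0" by (simp add: f_def)
  ultimately show ?thesis by (simp add: power3_eq_cube power2_eq_square f_def)
qed

lemma ln_quadratic_error:
  fixes z :: real
  assumes "\<bar>z\<bar> \<le> 1/2"
  shows "\<bar>ln (1 + z) - z + z^2/2\<bar> \<le> 2 * \<bar>z\<bar> ^ 3"
proof -
  have "norm (of_real (ln (1 + z) - z + z^2/2) :: complex) \<le> 2 * norm (of_real z :: complex) ^ 3"
  proof -
    have "Ln (1 + of_real z) = of_real (ln (1 + z))"
      using assms Ln_of_real[of "1 + z"] by simp
    then show ?thesis using Ln_quadratic_error[of "of_real z"] assms by simp
  qed
  then show ?thesis by (simp only: norm_of_real)
qed

text \<open>The increment 1/(2 x (x + 1)) of the correction -1/(2 x) cancels the second-order term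
  -1/(2 x^2) of ln (1 + 1/x) up to third order.\<close>

lemma harmonic_step_error:
  fixes x :: real
  assumes "x \<ge> 2"
  shows "\<bar>1/x - (ln (x + 1) - 1/(2*(x+1)) - (ln x - 1/(2*x)))\<bar> \<le> 3 / x^3"
proof -
  have "\<bar>ln (1 + 1/x) - 1/x + (1/x)^2/2\<bar> \<le> 2 * \<bar>1/x\<bar> ^ 3"
    by (rule ln_quadratic_error) (use assms in \<open>simp add: field_simps\<close>)
  then have 1: "\<bar>ln (1 + 1/x) - 1/x + (1/x)^2/2\<bar> \<le> 2 / x^3"
    using assms by (simp add: power_one_over)
  have 2: "ln (1 + 1/x) = ln (x + 1) - ln x"
  proof -
    have "1 + 1/x = (x + 1) / x" using assms by (simp add: field_simps)
    then show ?thesis using assms by (simp add: ln_div)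
  qed
  have "1/x - (ln (x + 1) - 1/(2*(x+1)) - (ln x - 1/(2*x)))
     = - (ln (1 + 1/x) - 1/x + (1/x)^2/2) + 1 / (2 * x^2 * (x+1))"
    unfolding 2 using assms by (simp add: divide_simps power2_eq_square) (simp add: algebra_simps)
  moreover have "0 \<le> 1 / (2 * x^2 * (x+1))" using assms by simp
  moreover have "1 / (2 * x^2 * (x+1)) \<le> 1 / x^3"
  proof (intro divide_left_mono)
    show "x^3 \<le> 2 * x^2 * (x+1)" using assms by (simp add: power2_eq_square power3_eq_cube algebra_simps)
  qed (use assms in auto)
  moreover have "2 / x^3 + 1/x^3 = 3 / x^3" by (simp add: add_divide_distrib[symmetric])
  ultimately show ?thesis using 1 by linarith
qed

lemma inverse_square_step_error:
  fixes x :: real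
  assumes "x > 0"
  shows "\<bar>1/x^2 - (1/x - 1/(x+1))\<bar> \<le> 1 / x^3"
proof -
  have "1/x^2 - (1/x - 1/(x+1)) = 1 / (x^2 * (x+1))"
    using assms by (simp add: divide_simps power2_eq_square)
  moreover have "\<dots> \<le> 1 / x^3"
  proof (intro divide_left_mono)
    show "x^3 \<le> x^2 * (x+1)" by (simp add: power2_eq_square power3_eq_cube algebra_simps)
  qed (use assms in auto)
  moreover have "0 \<le> 1 / (x^2 * (x+1))" using assms by simp
  ultimately show ?thesis by linarith
qed

lemma sum_inverse_cubes_le:
  fixes x :: real
  assumes "x \<ge> 2"
  shows "(\<Sum>j<N. 1 / (x + real j)^3) \<le> 2 / x^2"
proof -
  \<comment> \<open>\<open>g\<close> is the primitive -1/(2 u^2) of u^(-3) at u = x + j - 1, so its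
    increment is an integral over the unit interval ending at x + j, where the integrand is
    smallest. The final constant comes from x - 1 \<ge> x/2.\<close>
  define g where "g = (\<lambda>j. - 1 / (2 * (x + real j - 1)^2))"
  have "(\<Sum>j<N. 1 / (x + real j)^3) \<le> (\<Sum>j<N. g (Suc j) - g j)"
  proof (rule sum_mono)
    fix j
    define z where "z = x + real j"
    have z: "z \<ge> 2" using assms by (simp add: z_def)
    have eq: "g (Suc j) - g j = (2*z - 1) / (2 * z^2 * (z-1)^2)"
    proof -
      have "g (Suc j) = - 1 / (2 * z^2)" "g j = - 1 / (2 * (z-1)^2)"
        by (simp_all add: g_def z_def)
      then have "g (Suc j) - g j = 1 / (2 * (z-1)^2) - 1 / (2 * z^2)" by simp
      also have "\<dots> = (z^2 - (z-1)^2) / (2 * z^2 * (z-1)^2)"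
        using z by (subst diff_frac_eq) (auto simp: divide_simps)
      also have "z^2 - (z-1)^2 = 2*z - 1" by (simp add: power2_eq_square algebra_simps)
      finally show ?thesis .
    qed
    have "1 / z^3 = (1 * (2 * (z-1)^2)) / (z^3 * (2 * (z-1)^2))"
      using z by (intro nonzero_mult_divide_mult_cancel_right[symmetric]) simp
    also have "\<dots> = (2 * (z-1)^2) / (2 * z^3 * (z-1)^2)" by (simp only: mult_ac mult_1_left)
    also have "\<dots> \<le> (z * (2*z - 1)) / (2 * z^3 * (z-1)^2)"
    proof (intro divide_right_mono)
      show "2 * (z-1)^2 \<le> z * (2*z - 1)" using z by (simp add: power2_eq_square algebra_simps)
    qed (use z in auto)
    also have "2 * z^3 * (z-1)^2 = z * (2 * z^2 * (z-1)^2)"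
      by (simp add: power2_eq_square power3_eq_cube)
    also have "z * (2*z - 1) / \<dots> = (2*z - 1) / (2 * z^2 * (z-1)^2)"
      using z by (intro nonzero_mult_divide_mult_cancel_left) simp
    finally show "1 / (x + real j)^3 \<le> g (Suc j) - g j" unfolding eq z_def .
  qed
  also have "\<dots> = g N - g 0" by (rule sum_lessThan_telescope)
  also have "\<dots> \<le> 1 / (2 * (x - 1)^2)" by (simp add: g_def)
  also have "\<dots> \<le> 1 / (2 * (x / 2)^2)"
    using assms by (intro divide_left_mono mult_left_mono power_mono) auto
  also have "\<dots> = 2 / x^2" by (simp add: power2_eq_square)
  finally show ?thesis .
qed

text \<open>
  The increment of \<open>log_prim \<tau>\<close> from \<open>x\<close> to \<open>x + 1\<close> agrees with \<open>Ln (1 + \<i> \<tau> / x)\<close> up to order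
  \<open>x\<^sup>-\<^sup>3\<close>: its two parts come from the trapezoidal rule for \<open>1 / x\<close> and from \<open>1 / x\<^sup>2 \<approx> 1 / x - 1 / (x + 1)\<close>.
\<close>

definition log_prim :: "real \<Rightarrow> real \<Rightarrow> complex" where
  "log_prim \<tau> x = \<i> * of_real (\<tau> * (ln x - 1/(2*x))) - of_real (\<tau>^2 / 2 * (1/x))"

text \<open>With z = i \<tau> / x, the expansion z - z^2/2 has imaginary part \<tau>/x and real part
  \<tau>^2/(2 x^2), matched by \<open>harmonic_step_error\<close> and
  \<open>inverse_square_step_error\<close>. The bound on \<tau> keeps z in the disc where the
  remainder is cubic. The constant 5 majorises the coefficients 3, 1/2 and 2.\<close>

lemma log_prim_step:
  fixes x \<tau> :: real
  assumes "x \<ge> 2" "\<bar>\<tau>\<bar> \<le> x/2"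
  shows "norm (Ln (1 + \<i> * of_real (\<tau> / x)) - (log_prim \<tau> (x+1) - log_prim \<tau> x))
         \<le> 5 * (\<bar>\<tau>\<bar> + \<tau>^2 + \<bar>\<tau>\<bar>^3) / x^3"
proof -
  define A where "A = 1/x - (ln (x + 1) - 1/(2*(x+1)) - (ln x - 1/(2*x)))"
  define B where "B = 1/x^2 - (1/x - 1/(x+1))"
  define z where "z = \<i> * complex_of_real (\<tau> / x)"
  define e where "e = Ln (1 + z) - z + z^2/2"
  have nz: "norm z = \<bar>\<tau>\<bar> / x" using assms by (simp add: z_def norm_mult norm_divide)
  have e: "norm e \<le> 2 * \<bar>\<tau>\<bar>^3 / x^3"
  proof -
    have "norm z \<le> 1/2" using assms by (simp add: nz field_simps)
    then have "norm e \<le> 2 * norm z ^ 3" unfolding e_def by (rule Ln_quadratic_error)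
    then show ?thesis by (simp add: nz power_divide)
  qed
  have z2: "z^2 = - of_real (\<tau>^2 * (1/x^2))" by (simp add: z_def power_mult_distrib power_divide)
  have "Ln (1 + z) - (log_prim \<tau> (x+1) - log_prim \<tau> x)
      = e + z - z^2/2 - (log_prim \<tau> (x+1) - log_prim \<tau> x)" by (simp add: e_def)
  also have "\<dots> = e + \<i> * of_real (\<tau> * A) + of_real (\<tau>^2/2 * B)"
  proof -
    define P Q where "P = (\<lambda>x::real. ln x - 1/(2*x))" and "Q = (\<lambda>x::real. 1/x)"
    have H: "log_prim \<tau> u = \<i> * of_real (\<tau> * P u) - of_real (\<tau>^2/2 * Q u)" for u
      by (simp add: log_prim_def P_def Q_def)
    have z: "z = \<i> * of_real (\<tau> * (1/x))" by (simp add: z_def)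
    have A: "A = 1/x - (P (x+1) - P x)" and B: "B = 1/x^2 - (Q x - Q (x+1))"
      by (simp_all add: A_def B_def P_def Q_def)
    show ?thesis
      unfolding z2 unfolding H A B z
      by (rule complex_eqI) (simp_all add: algebra_simps)
  qed
  also have "norm \<dots> \<le> norm e + norm (\<i> * of_real (\<tau> * A)) + norm (of_real (\<tau>^2/2 * B) :: complex)"
    by (intro norm_triangle_le add_mono norm_triangle_ineq order_refl)
  also have "\<dots> = norm e + \<bar>\<tau>\<bar> * \<bar>A\<bar> + \<tau>^2/2 * \<bar>B\<bar>"
    by (simp only: norm_mult norm_of_real abs_mult norm_ii) simp
  also have "\<dots> \<le> 2 * \<bar>\<tau>\<bar>^3 / x^3 + \<bar>\<tau>\<bar> * (3 / x^3) + \<tau>^2/2 * (1/x^3)"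
    using harmonic_step_error[OF assms(1)] inverse_square_step_error[of x] assms(1)
    by (intro add_mono mult_left_mono e) (auto simp: A_def B_def)
  also have "\<dots> = (2 * \<bar>\<tau>\<bar>^3 + 3 * \<bar>\<tau>\<bar> + \<tau>^2/2) / x^3" by (simp add: add_divide_distrib)
  also have "\<dots> \<le> 5 * (\<bar>\<tau>\<bar> + \<tau>^2 + \<bar>\<tau>\<bar>^3) / x^3"
    using assms by (intro divide_right_mono) (auto simp: algebra_simps)
  finally show ?thesis unfolding z_def .
qed

lemma sum_log_prim:
  fixes x \<tau> :: real
  assumes "x \<ge> 2" "\<bar>\<tau>\<bar> \<le> x/2"
  shows "norm ((\<Sum>j<N. Ln (1 + \<i> * of_real (\<tau> / (x + real j)))) - (log_prim \<tau> (x + real N) - log_prim \<tau> x))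
         \<le> 10 * (\<bar>\<tau>\<bar> + \<tau>^2 + \<bar>\<tau>\<bar>^3) / x^2"
proof -
  have "log_prim \<tau> (x + real N) - log_prim \<tau> x
      = (\<Sum>j<N. log_prim \<tau> (x + real j + 1) - log_prim \<tau> (x + real j))"
    using sum_lessThan_telescope[of "\<lambda>j. log_prim \<tau> (x + real j)" N] by (simp add: algebra_simps)
  then have "norm ((\<Sum>j<N. Ln (1 + \<i> * of_real (\<tau> / (x + real j)))) - (log_prim \<tau> (x + real N) - log_prim \<tau> x))
     = norm (\<Sum>j<N. Ln (1 + \<i> * of_real (\<tau> / (x + real j))) - (log_prim \<tau> (x + real j + 1) - log_prim \<tau> (x + real j)))"
    by (simp add: sum_subtractf)
  also have "\<dots> \<le> (\<Sum>j<N. 5 * (\<bar>\<tau>\<bar> + \<tau>^2 + \<bar>\<tau>\<bar>^3) / (x + real j)^3)"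
    using assms by (intro sum_norm_le log_prim_step) auto
  also have "\<dots> = 5 * (\<bar>\<tau>\<bar> + \<tau>^2 + \<bar>\<tau>\<bar>^3) * (\<Sum>j<N. 1 / (x + real j)^3)"
    by (simp add: sum_distrib_left)
  also have "\<dots> \<le> 5 * (\<bar>\<tau>\<bar> + \<tau>^2 + \<bar>\<tau>\<bar>^3) * (2 / x^2)"
    by (intro mult_left_mono sum_inverse_cubes_le assms) auto
  finally show ?thesis by simp
qed

section \<open>Solving the moment recurrence\<close>

text \<open>Termwise comparison of the power series. Relative errors are kept in the form
  \<open>exp b - 1\<close> because such bounds multiply exactly: factors within exp b - 1 and exp c
  - 1 of 1 have a product within exp (b + c) - 1 of 1.\<close>

lemma norm_exp_minus_one_le:
  fixes w :: complex
  assumes "norm w \<le> b"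
  shows "norm (exp w - 1) \<le> exp b - 1"
proof -
  have "norm (exp w - 1) \<le> exp (norm w) - 1"
  proof -
    have s: "(\<lambda>n. w ^ Suc n /\<^sub>R fact (Suc n)) sums (exp w - 1)"
      using exp_converges[of w] by (subst sums_Suc_iff) simp
    have t: "(\<lambda>n. norm w ^ Suc n /\<^sub>R fact (Suc n)) sums (exp (norm w) - 1)"
      using exp_converges[of "norm w"] by (subst sums_Suc_iff) simp
    have "norm (\<Sum>n. w ^ Suc n /\<^sub>R fact (Suc n)) \<le> (\<Sum>n. norm w ^ Suc n /\<^sub>R fact (Suc n))"
      by (rule norm_suminf_le[OF _ sums_summable[OF t]]) (simp add: norm_power norm_mult)
    then show ?thesis using s t by (simp only: sums_iff)
  qed
  also have "\<dots> \<le> exp b - 1" using assms by simp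
  finally show ?thesis .
qed

text \<open>The logarithms differ by that of a ratio tending to 1. This cancels at infinity the end
  points of two telescoped sums with different starting points.\<close>

lemma log_prim_diff_tendsto:
  "(\<lambda>N. log_prim \<tau> (u + real N) - log_prim \<tau> (v + real N)) \<longlonglongrightarrow> 0"
proof -
  have 1: "(\<lambda>N. \<tau> * (ln (u + real N) - 1/(2*(u + real N))) - \<tau> * (ln (v + real N) - 1/(2*(v + real N)))) \<longlonglongrightarrow> 0"
    by real_asymp
  have 2: "(\<lambda>N. \<tau>^2 / 2 * (1/(u + real N)) - \<tau>^2 / 2 * (1/(v + real N))) \<longlonglongrightarrow> 0"
    by real_asymp
  have "(\<lambda>N. \<i> * of_real (\<tau> * (ln (u + real N) - 1/(2*(u + real N))) - \<tau> * (ln (v + real N) - 1/(2*(v + real N))))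
      - of_real (\<tau>^2 / 2 * (1/(u + real N)) - \<tau>^2 / 2 * (1/(v + real N)))) \<longlonglongrightarrow> \<i> * of_real 0 - (of_real 0 :: complex)"
    by (intro tendsto_intros 1 2)
  then show ?thesis
    by (simp add: log_prim_def of_real_diff algebra_simps)
qed

text \<open>The intended values are \<open>\<psi> N\<close> = E U^(N + i \<tau>) and
  \<open>\<mu> N\<close> = E U^N. A linear recurrence fixes \<open>\<psi>\<close> only up to a
  factor; the normalisation is supplied at infinity, where \<open>close\<close> forces the quotient
  of the two moments to 1. The bounds on \<open>a\<close> and \<open>\<tau>\<close> put d/2 and a/2
  in the range of \<open>sum_log_prim\<close>.\<close>

lemma beta_recurrence_estimate:
  fixes \<psi> :: "nat \<Rightarrow> complex" and \<mu> :: "nat \<Rightarrow> real" and a d \<tau> :: real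
  assumes ad: "4 \<le> a" "a \<le> d" and \<tau>: "4 * \<bar>\<tau>\<bar> \<le> a"
    and \<psi>: "\<And>N. (of_real (d/2 + real N) + \<i> * of_real \<tau>) * \<psi> (Suc N) = (of_real (a/2 + real N) + \<i> * of_real \<tau>) * \<psi> N"
    and \<mu>: "\<And>N. (d/2 + real N) * \<mu> (Suc N) = (a/2 + real N) * \<mu> N" "\<mu> 0 = 1"
    and close: "\<And>N. norm (\<psi> (Suc N) - of_real (\<mu> (Suc N))) \<le> \<bar>\<tau>\<bar> * (\<mu> N - \<mu> (Suc N))"
  shows "norm (\<psi> 0 * exp (log_prim \<tau> (d/2) - log_prim \<tau> (a/2)) - 1)
       \<le> exp (80 * (\<bar>\<tau>\<bar> + \<tau>^2 + \<bar>\<tau>\<bar>^3) / a^2) - 1"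
proof -
  define K where "K = \<bar>\<tau>\<bar> + \<tau>^2 + \<bar>\<tau>\<bar>^3"
  define B where "B = 80 * K / a^2"
  define L where "L = (\<lambda>x. Ln (1 + \<i> * of_real (\<tau> / x)))"
  define P where "P = (\<lambda>x N. \<Sum>j<N. L (x + real j))"
  define c where "c = (\<lambda>N. \<psi> N / of_real (\<mu> N))"
  have \<mu>_pos: "\<mu> N > 0" for N
  proof (induction N)
    case (Suc N)
    have "0 < (d/2 + real N) * \<mu> (Suc N)" unfolding \<mu>(1) using Suc ad by simp
    then show ?case using ad by (simp add: zero_less_mult_iff)
  qed (simp add: \<mu>)
  have expL: "of_real x + \<i> * of_real \<tau> = of_real x * exp (L x)" if "x > 0" for x
  proof -
    have "1 + \<i> * of_real (\<tau> / x) \<noteq> 0" by (simp add: complex_eq_iff)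
    then have "exp (L x) = 1 + \<i> * of_real (\<tau> / x)" by (simp add: L_def)
    then show ?thesis using that by (simp add: field_simps)
  qed
  \<comment> \<open>Dividing the complex recurrence by the real one cancels the real factors and
    leaves only the quotients 1 + i \<tau> / x, written as exponentials of \<open>L\<close>.\<close>
  have step: "c (Suc N) * exp (L (d/2 + real N)) = c N * exp (L (a/2 + real N))" for N
  proof -
    have p: "d/2 + real N > 0" "a/2 + real N > 0" using ad by auto
    have "of_real ((d/2 + real N) * \<mu> (Suc N)) * (c (Suc N) * exp (L (d/2 + real N)))
        = of_real (d/2 + real N) * exp (L (d/2 + real N)) * \<psi> (Suc N)"
      using \<mu>_pos[of "Suc N"] by (simp add: c_def)
    also have "\<dots> = of_real (a/2 + real N) * exp (L (a/2 + real N)) * \<psi> N"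
      using \<psi>[of N] unfolding expL[OF p(1)] expL[OF p(2)] .
    also have "\<dots> = of_real ((a/2 + real N) * \<mu> N) * (c N * exp (L (a/2 + real N)))"
      using \<mu>_pos[of N] by (simp add: c_def)
    also have "(a/2 + real N) * \<mu> N = (d/2 + real N) * \<mu> (Suc N)" using \<mu> by simp
    finally show ?thesis using p \<mu>_pos[of "Suc N"]
      by (simp del: of_real_add of_real_divide of_real_mult)
  qed
  have c0: "\<psi> 0 = c N * exp (P (d/2) N - P (a/2) N)" for N
  proof (induction N)
    case 0 show ?case by (simp add: c_def \<mu> P_def)
  next
    case (Suc N)
    have "c (Suc N) * exp (P (d/2) (Suc N) - P (a/2) (Suc N))
       = (c (Suc N) * exp (L (d/2 + real N))) * exp (P (d/2) N - P (a/2) N - L (a/2 + real N))"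
      by (simp add: P_def exp_add exp_diff)
    also have "\<dots> = c N * exp (P (d/2) N - P (a/2) N)"
      unfolding step by (simp add: exp_diff)
    finally show ?case using Suc by simp
  qed
  have clim: "c \<longlonglongrightarrow> 1"
  proof (rule LIMSEQ_imp_Suc, rule LIM_zero_cancel, rule Lim_null_comparison)
    show "\<forall>\<^sub>F N in sequentially. norm (c (Suc N) - 1) \<le> \<bar>\<tau>\<bar> * ((d - a) / (a + 2 * real N))"
    proof (intro always_eventually allI)
      fix N
      have "c (Suc N) - 1 = (\<psi> (Suc N) - of_real (\<mu> (Suc N))) / of_real (\<mu> (Suc N))"
        using \<mu>_pos[of "Suc N"] by (simp add: c_def diff_divide_distrib)
      then have "norm (c (Suc N) - 1) = norm (\<psi> (Suc N) - of_real (\<mu> (Suc N))) / \<mu> (Suc N)"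
        using \<mu>_pos[of "Suc N"] by (simp add: norm_divide)
      also have "\<dots> \<le> \<bar>\<tau>\<bar> * (\<mu> N - \<mu> (Suc N)) / \<mu> (Suc N)"
        using \<mu>_pos[of "Suc N"] close[of N] by (intro divide_right_mono) auto
      \<comment> \<open>The real recurrence makes the relative gap between consecutive moments
        explicit.\<close>
      also have "\<dots> = \<bar>\<tau>\<bar> * ((d - a) / (a + 2 * real N))"
      proof -
        have "\<mu> N = (d/2 + real N) * \<mu> (Suc N) / (a/2 + real N)"
          using \<mu>(1)[of N] ad by (simp add: field_simps)
        then have "(\<mu> N - \<mu> (Suc N)) / \<mu> (Suc N) = (d/2 + real N) / (a/2 + real N) - 1"
          using \<mu>_pos[of "Suc N"] by (simp add: diff_divide_distrib)
        also have "\<dots> = (d - a) / (a + 2 * real N)" using ad by (simp add: field_simps)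
        finally show ?thesis by (metis times_divide_eq_right)
      qed
      finally show "norm (c (Suc N) - 1) \<le> \<bar>\<tau>\<bar> * ((d - a) / (a + 2 * real N))" .
    qed
    show "(\<lambda>N. \<bar>\<tau>\<bar> * ((d - a) / (a + 2 * real N))) \<longlonglongrightarrow> 0" by real_asymp
  qed
  \<comment> \<open>For every \<open>N\<close> the quantity to be estimated equals
    \<open>q N * exp (w N)\<close>: \<open>q\<close> tends to 1, and \<open>w\<close> collects the
    telescoping errors, bounded by \<open>B\<close> uniformly in \<open>N\<close>.\<close>
  define q where "q = (\<lambda>N. c N * exp (log_prim \<tau> (d/2 + real N) - log_prim \<tau> (a/2 + real N)))"
  define w where "w = (\<lambda>N. (P (d/2) N - (log_prim \<tau> (d/2 + real N) - log_prim \<tau> (d/2)))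
                         - (P (a/2) N - (log_prim \<tau> (a/2 + real N) - log_prim \<tau> (a/2))))"
  have qlim: "q \<longlonglongrightarrow> 1"
    using tendsto_mult[OF clim tendsto_exp[OF log_prim_diff_tendsto[of \<tau> "d/2" "a/2"]]]
    by (simp add: q_def)
  have K0: "K \<ge> 0" by (simp add: K_def)
  have wB: "norm (w N) \<le> B" for N
  proof -
    have "norm (w N) \<le> 10 * K / (d/2)^2 + 10 * K / (a/2)^2"
      unfolding w_def P_def L_def K_def
      by (rule norm_triangle_le_diff, rule add_mono; rule sum_log_prim) (use ad \<tau> in auto)
    also have "10 * K / (d/2)^2 \<le> 10 * K / (a/2)^2"
      using ad K0 by (intro divide_left_mono power_mono) auto
    \<comment> \<open>Each of the two errors is at most 40 K / a^2, whence the 80.\<close>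
    also have "10 * K / (a/2)^2 + 10 * K / (a/2)^2 = B" by (simp add: B_def power_divide)
    finally show ?thesis by simp
  qed
  have eq: "\<psi> 0 * exp (log_prim \<tau> (d/2) - log_prim \<tau> (a/2)) = q N * exp (w N)" for N
    unfolding c0[of N] q_def w_def mult.assoc exp_add[symmetric] by (simp add: algebra_simps)
  have "norm (\<psi> 0 * exp (log_prim \<tau> (d/2) - log_prim \<tau> (a/2)) - 1) \<le> norm (q N - 1) * exp B + (exp B - 1)" for N
  proof -
    have "\<psi> 0 * exp (log_prim \<tau> (d/2) - log_prim \<tau> (a/2)) - 1 = (q N - 1) * exp (w N) + (exp (w N) - 1)"
      unfolding eq[of N] by (simp add: algebra_simps)
    also have "norm \<dots> \<le> norm (q N - 1) * norm (exp (w N)) + norm (exp (w N) - 1)"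
      by (rule norm_triangle_le) (simp add: norm_mult)
    also have "norm (exp (w N)) \<le> exp B"
      using norm_exp[of "w N"] wB[of N] by (meson exp_le_cancel_iff order_trans)
    finally show ?thesis using norm_exp_minus_one_le[OF wB[of N]] by (simp add: mult_left_mono)
  qed
  moreover have "(\<lambda>N. norm (q N - 1) * exp B + (exp B - 1)) \<longlonglongrightarrow> norm (1 - 1 :: complex) * exp B + (exp B - 1)"
    by (intro tendsto_intros qlim)
  ultimately have "norm (\<psi> 0 * exp (log_prim \<tau> (d/2) - log_prim \<tau> (a/2)) - 1) \<le> norm (1 - 1 :: complex) * exp B + (exp B - 1)"
    by (intro LIMSEQ_le_const) auto
  then show ?thesis by (simp add: B_def K_def)
qed

section \<open>Matching the sum over columns with \<open>mu_n\<close> and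
  \<open>sigma_sq_n\<close>\<close>

text \<open>The first terms are the coefficients of i \<tau> and -\<tau>^2/2 in
  \<open>log_prim \<tau> (a/2) - log_prim \<tau> (m/2)\<close>, the exponent contributed by column
  \<open>i\<close>; centring and variance are thus recognised by their increments in the number of
  columns. Since 1 - (i + 1)/m = (1 - 1/a) (a/m), only ln (1 - 1/a) has to be expanded.\<close>

lemma mu_sigma_step:
  fixes n i :: nat
  assumes i: "i + 5 \<le> n"
  defines "m \<equiv> real n - 1" and "a \<equiv> real n - 1 - real i"
  shows "\<bar>(ln (a/2) - 1/a) - (ln (m/2) - 1/m) - (mu_n n (Suc i) - mu_n n i)\<bar> \<le> 3 / a^2" (is "\<bar>?A\<bar> \<le> _")
    and "\<bar>2/a - 2/m - (sigma_sq_n n (Suc i) - sigma_sq_n n i)\<bar> \<le> 3 / a^2" (is "\<bar>?B\<bar> \<le> _")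
proof -
  define z where "z = 1/a"
  have a4: "a \<ge> 4" and m4: "m \<ge> 4" using i by (auto simp: a_def m_def)
  have z: "0 < z" "z \<le> 1/4" using a4 by (auto simp: z_def field_simps)
  define e where "e = ln (1 - z) + z + z^2/2"
  have e: "\<bar>e\<bar> \<le> 2 * z^3" using ln_quadratic_error[of "-z"] z by (simp add: e_def)
  have az: "a * z = 1" using a4 by (simp add: z_def)
  have ln: "ln (1 - z) = e - z - z^2/2" by (simp add: e_def)
  have l1: "1 - real i / m = a / m" using m4 by (simp add: a_def m_def diff_divide_distrib)
  have l2: "1 - real (Suc i) / m = (1 - z) * (a / m)"
  proof -
    have "(1 - z) * (a / m) = (a - a * z) / m" by (simp add: algebra_simps diff_divide_distrib)
    also have "\<dots> = (m - real (Suc i)) / m" unfolding az by (simp add: a_def m_def)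
    also have "\<dots> = 1 - real (Suc i) / m" using m4 by (simp add: diff_divide_distrib)
    finally show ?thesis by simp
  qed
  have l3: "ln (1 - real (Suc i) / m) = ln (1 - z) + ln (a / m)"
    unfolding l2 using z a4 m4 by (intro ln_mult_pos) auto
  have l4: "ln (a / m) = ln (a/2) - ln (m/2)" using a4 m4 by (simp add: ln_div)
  have q: "(real n - 2) / m = 1 - 1/m"
  proof -
    have "real n - 2 = m - 1" by (simp add: m_def)
    then show ?thesis using m4 by (simp add: diff_divide_distrib)
  qed
  have c: "real (Suc i) - real n + 3/2 = 3/2 - a" "real i - real n + 3/2 = 1/2 - a"
    by (simp_all add: a_def)
  have mu: "mu_n n (Suc i) - mu_n n i = (3/2 - a) * (ln (1 - z) + ln (a/m)) - (1/2 - a) * ln (a / m) - (1 - 1/m)"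
    unfolding mu_n_def m_def[symmetric] l1 l3 q c by (simp add: algebra_simps)
  have "?A = 1 - z - (3/2 - a) * ln (1 - z)"
    unfolding mu l4 z_def[symmetric] by (simp add: algebra_simps)
  also have "\<dots> = 1 - z - 3/2 * (e - z - z^2/2) + a * e - a * z - (a * z) * z / 2"
    unfolding ln by (simp add: algebra_simps power2_eq_square)
  also have "\<dots> = 3/4 * z^2 + (a - 3/2) * e"
    unfolding az by (simp add: algebra_simps)
  finally have "\<bar>?A\<bar> \<le> \<bar>3/4 * z^2\<bar> + \<bar>(a - 3/2) * e\<bar>" by linarith
  also have "\<dots> = 3/4 * z^2 + (a - 3/2) * \<bar>e\<bar>" using a4 by (simp add: abs_mult)
  also have "\<dots> \<le> 3/4 * z^2 + a * (2 * z^3)"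
    using a4 e by (intro add_mono mult_mono) auto
  also have "a * (2 * z^3) = (a * z) * 2 * z^2" by (simp add: power2_eq_square power3_eq_cube)
  also have "3/4 * z^2 + \<dots> \<le> 3 * z^2" unfolding az by simp
  also have "3 * z^2 = 3 / a^2" by (simp add: z_def power_divide)
  finally show "\<bar>?A\<bar> \<le> 3 / a^2" .
  have "sigma_sq_n n (Suc i) - sigma_sq_n n i = - 2 * ln (1 - z) - 2/m"
    unfolding sigma_sq_n_def m_def[symmetric] l1 l3 by (simp add: algebra_simps add_divide_distrib)
  moreover have "2/a = 2 * z" by (simp add: z_def)
  ultimately have "?B = 2 * e - z^2" unfolding ln by simp
  moreover have "z^3 \<le> z^2 * (1/4)"
    using z by (simp add: power2_eq_square power3_eq_cube mult_left_mono)
  ultimately have "\<bar>?B\<bar> \<le> 3 * z^2" using e zero_le_power2[of z] unfolding abs_le_iff by auto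
  also have "3 * z^2 = 3 / a^2" by (simp add: z_def power_divide)
  finally show "\<bar>?B\<bar> \<le> 3 / a^2" .
qed

text \<open>Bounding 1/a^2 by 1/(a - 1) - 1/a telescopes. Summing the column errors thus gives the
  rate 1/(n - 1 - p) of the final estimate.\<close>

lemma sum_inverse_squares_le:
  fixes n p :: nat
  assumes "p + 5 \<le> n"
  shows "(\<Sum>i<p. 1 / (real n - 1 - real i)^2) \<le> 1 / (real n - 1 - real p)"
proof -
  define g where "g = (\<lambda>i. 1 / (real n - 1 - real i))"
  have "(\<Sum>i<p. 1 / (real n - 1 - real i)^2) \<le> (\<Sum>i<p. g (Suc i) - g i)"
  proof (rule sum_mono)
    fix i assume "i \<in> {..<p}"
    then have i: "i + 6 \<le> n" using assms by auto
    define a where "a = real n - 1 - real i"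
    have a: "a \<ge> 5" using i by (simp add: a_def)
    have "1 / a^2 \<le> 1 / (a * (a - 1))"
      using a by (intro divide_left_mono) (auto simp: power2_eq_square)
    also have "\<dots> = 1 / (a - 1) - 1 / a" using a by (subst diff_frac_eq) auto
    also have "\<dots> = g (Suc i) - g i" by (simp add: g_def a_def)
    finally show "1 / (real n - 1 - real i)^2 \<le> g (Suc i) - g i" by (simp add: a_def)
  qed
  also have "\<dots> = g p - g 0" by (rule sum_lessThan_telescope)
  also have "\<dots> \<le> 1 / (real n - 1 - real p)" using assms by (simp add: g_def)
  finally show ?thesis .
qed

lemma prod_beta_estimate:
  fixes \<psi> :: "nat \<Rightarrow> complex" and n p :: nat and \<tau> :: real
  assumes np: "p + 5 \<le> n"
  defines "K \<equiv> \<bar>\<tau>\<bar> + \<tau>^2 + \<bar>\<tau>\<bar>^3" and "H \<equiv> \<lambda>i. log_prim \<tau> ((real n - 1 - real i) / 2)"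
  assumes \<psi>: "\<And>i. i < p \<Longrightarrow>
     norm (\<psi> i * exp (H 0 - H i) - 1) \<le> exp (80 * K / (real n - 1 - real i)^2) - 1"
  shows "norm ((\<Prod>i<p. \<psi> i) * exp (- (\<i> * of_real (\<tau> * mu_n n p) - of_real (\<tau>^2/2 * sigma_sq_n n p))) - 1)
     \<le> exp (90 * K / (real n - 1 - real p)) - 1"
proof -
  \<comment> \<open>\<open>T i\<close> is the target exponent for the first \<open>i\<close>
    columns, and \<open>f i\<close> the relative error of column \<open>i\<close> against one
    increment of \<open>T\<close>.\<close>
  define T where "T = (\<lambda>i. \<i> * of_real (\<tau> * mu_n n i) - of_real (\<tau>^2/2 * sigma_sq_n n i) :: complex)"
  define f where "f = (\<lambda>i. \<psi> i * exp (- (T (Suc i) - T i)) - 1)"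
  define a where "a = (\<lambda>i. real n - 1 - real i)"
  have K0: "K \<ge> 0" by (simp add: K_def)
  have f: "norm (f i) \<le> exp (90 * K / (a i)^2) - 1" if i: "i < p" for i
  proof -
    have i5: "i + 5 \<le> n" using i np by simp
    define A where "A = (ln (a i/2) - 1/a i) - (ln (a 0/2) - 1/a 0) - (mu_n n (Suc i) - mu_n n i)"
    define B where "B = 2/a i - 2/a 0 - (sigma_sq_n n (Suc i) - sigma_sq_n n i)"
    define w where "w = H i - H 0 - (T (Suc i) - T i)"
    have AB: "\<bar>A\<bar> \<le> 3 / (a i)^2" "\<bar>B\<bar> \<le> 3 / (a i)^2"
      using mu_sigma_step[OF i5] by (simp_all add: A_def B_def a_def)
    have "w = \<i> * of_real (\<tau> * A) - of_real (\<tau>^2/2 * B)"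
    proof -
      define P Q where "P = (\<lambda>x::real. ln (x/2) - 1/x)" and "Q = (\<lambda>x::real. 2/x)"
      have H: "H j = \<i> * of_real (\<tau> * P (a j)) - of_real (\<tau>^2/2 * Q (a j))" for j
      proof -
        have "log_prim \<tau> (x / 2) = \<i> * of_real (\<tau> * P x) - of_real (\<tau>^2/2 * Q x)" for x
          by (simp add: log_prim_def P_def Q_def)
        then show ?thesis by (simp only: H_def a_def)
      qed
      have A: "A = P (a i) - P (a 0) - (mu_n n (Suc i) - mu_n n i)"
       and B: "B = Q (a i) - Q (a 0) - (sigma_sq_n n (Suc i) - sigma_sq_n n i)"
        by (simp_all add: A_def B_def P_def Q_def)
      show ?thesis unfolding w_def H A B T_def
        by (rule complex_eqI) (simp_all add: algebra_simps)
    qed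
    then have "norm w \<le> norm (\<i> * of_real (\<tau> * A)) + norm (of_real (\<tau>^2/2 * B) :: complex)"
      by (simp only: norm_triangle_ineq4)
    also have "\<dots> = \<bar>\<tau>\<bar> * \<bar>A\<bar> + \<tau>^2/2 * \<bar>B\<bar>"
      by (simp only: norm_mult norm_of_real abs_mult norm_ii) simp
    also have "\<dots> \<le> \<bar>\<tau>\<bar> * (3 / (a i)^2) + \<tau>^2/2 * (3 / (a i)^2)"
      by (intro add_mono mult_left_mono AB) auto
    also have "\<dots> = (3 * \<bar>\<tau>\<bar> + 3/2 * \<tau>^2) / (a i)^2" by (simp add: add_divide_distrib)
    \<comment> \<open>The coefficients 3 and 3/2 are absorbed into 10 K; added to the 80 K of the
      hypothesis this makes 90 K.\<close>
    also have "\<dots> \<le> 10 * K / (a i)^2"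
      by (intro divide_right_mono) (auto simp: K_def)
    finally have w: "norm w \<le> 10 * K / (a i)^2" .
    define x where "x = \<psi> i * exp (H 0 - H i)"
    have x: "norm (x - 1) \<le> exp (80 * K / (a i)^2) - 1" using \<psi>[OF i] by (simp add: x_def a_def)
    have "f i = x * exp w - 1"
      by (simp add: f_def x_def w_def mult.assoc exp_add[symmetric] algebra_simps)
    also have "\<dots> = (x - 1) * exp w + (exp w - 1)" by (simp add: algebra_simps)
    finally have "norm (f i) \<le> norm (x - 1) * norm (exp w) + norm (exp w - 1)"
      by (metis norm_mult norm_triangle_ineq)
    also have "\<dots> \<le> (exp (80 * K / (a i)^2) - 1) * exp (10 * K / (a i)^2) + (exp (10 * K / (a i)^2) - 1)"
      using norm_exp[of w] w K0
      by (intro add_mono mult_mono x norm_exp_minus_one_le order_trans[OF norm_exp]) auto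
    also have "\<dots> = exp (80 * K / (a i)^2 + 10 * K / (a i)^2) - 1"
      unfolding exp_add by (simp add: left_diff_distrib)
    also have "80 * K / (a i)^2 + 10 * K / (a i)^2 = 90 * K / (a i)^2"
      by (simp flip: add_divide_distrib)
    finally show ?thesis .
  qed
  have "(\<Prod>i<p. 1 + f i) = (\<Prod>i<p. \<psi> i) * exp (- T p)"
  proof -
    have "T 0 = 0" by (simp add: T_def mu_n_def sigma_sq_n_def)
    then have "(\<Sum>i<p. T (Suc i) - T i) = T p" using sum_lessThan_telescope[of T p] by simp
    then have "(\<Prod>i<p. exp (- (T (Suc i) - T i))) = exp (- T p)"
      by (simp only: exp_sum[symmetric] finite_lessThan sum_negf)
    then show ?thesis by (simp add: f_def prod.distrib)
  qed
  then have "norm ((\<Prod>i<p. \<psi> i) * exp (- T p) - 1) \<le> (\<Prod>i<p. 1 + norm (f i)) - 1"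
    using norm_prod_minus1_le_prod_minus1[of f "{..<p}"] by simp
  also have "(\<Prod>i<p. 1 + norm (f i)) - 1 \<le> exp (90 * K / (real n - 1 - real p)) - 1"
  proof -
    have "(\<Prod>i<p. 1 + norm (f i)) \<le> (\<Prod>i<p. exp (90 * K / (a i)^2))"
    using f by (intro prod_mono) (auto simp: add_nonneg_nonneg le_diff_eq add.commute)
  also have "\<dots> = exp (90 * K * (\<Sum>i<p. 1 / (a i)^2))"
    by (simp add: exp_sum[symmetric] sum_distrib_left)
  also have "\<dots> \<le> exp (90 * K / (real n - 1 - real p))"
    using mult_left_mono[OF sum_inverse_squares_le[OF np], of "90 * K"] K0 by (simp add: a_def)
    finally show ?thesis by simp
  qed
  finally show ?thesis unfolding T_def .
qed

section \<open>The rescaled frequency in the two limiting regimes\<close>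

text \<open>For y < 1 the variance has a finite positive limit and n - 1 - p tends to infinity. For
  y = 1 the difference n - 1 - p may stay bounded, but the variance diverges and \<tau> tends to 0.
  The last conclusion is the restriction on the frequency under which every column can be
  estimated.\<close>

lemma sigma_asymptotics:
  fixes p :: "nat \<Rightarrow> nat" and y t :: real
  assumes dim: "\<forall>\<^sub>F n in sequentially. p n + 5 \<le> n"
    and lim: "(\<lambda>n. real (p n) / real n) \<longlonglongrightarrow> y"
    and y: "0 < y" "y \<le> 1"
  defines "\<tau> \<equiv> \<lambda>n. t / sqrt (sigma_sq_n n (p n))"
  shows "(\<lambda>n. (\<bar>\<tau> n\<bar> + (\<tau> n)^2 + \<bar>\<tau> n\<bar>^3) / (real n - 1 - real (p n))) \<longlonglongrightarrow> 0"
    and "\<forall>\<^sub>F n in sequentially. sigma_sq_n n (p n) > 0"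
    and "\<forall>\<^sub>F n in sequentially. p n > 0"
    and "\<forall>\<^sub>F n in sequentially. 4 * \<bar>\<tau> n\<bar> \<le> real n - 1 - real (p n)"
proof -
  define x where "x = (\<lambda>n. real (p n) / (real n - 1))"
  have "(\<lambda>n. real (p n) / real n * (real n / (real n - 1))) \<longlonglongrightarrow> y * 1"
    by (intro tendsto_mult lim) real_asymp
  moreover have "\<forall>\<^sub>F n in sequentially. real (p n) / real n * (real n / (real n - 1)) = x n"
    using eventually_gt_at_top[of 1] by eventually_elim (simp add: x_def)
  ultimately have xlim: "x \<longlonglongrightarrow> y"
    using Lim_transform_eventually by fastforce
  have "\<forall>\<^sub>F n in sequentially. x n > 0" using xlim y by (auto dest: order_tendstoD)
  then show ppos: "\<forall>\<^sub>F n in sequentially. p n > 0"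
    by eventually_elim (auto simp: x_def intro!: gr0I)
  have x01: "\<forall>\<^sub>F n in sequentially. 0 < x n \<and> x n < 1"
    using ppos dim by eventually_elim (auto simp: x_def)
  have ln_less: "ln (1 - u) < - u" if "0 < u" "u < 1" for u :: real
    using ln_le_minus_one[of "1-u"] ln_eq_minus_one[of "1-u"] that by force
  have sig: "sigma_sq_n n (p n) = -2 * (x n + ln (1 - x n))" for n
    by (simp add: sigma_sq_n_def x_def)
  show sigpos: "\<forall>\<^sub>F n in sequentially. sigma_sq_n n (p n) > 0"
    using x01 unfolding sig by eventually_elim (use ln_less in force)
  define \<kappa> where "\<kappa> = (\<lambda>n. 1 / (real n - 1 - real (p n)))"
  \<comment> \<open>For y = 1 only this boundedness of \<open>\<kappa>\<close> is used; the decay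
    then comes from \<open>\<tau>\<close>.\<close>
  have \<kappa>: "\<forall>\<^sub>F n in sequentially. 0 < \<kappa> n \<and> \<kappa> n \<le> 1"
    using dim by eventually_elim (auto simp: \<kappa>_def)
  have key: "(\<lambda>n. \<bar>\<tau> n\<bar> ^ k * \<kappa> n) \<longlonglongrightarrow> 0" if k: "k > 0" for k
  proof (cases "y < 1")
    case True
    have "(\<lambda>n. sigma_sq_n n (p n)) \<longlonglongrightarrow> -2 * (y + ln (1 - y))"
      unfolding sig using True by (intro tendsto_intros xlim) auto
    moreover have "-2 * (y + ln (1 - y)) > 0" using ln_less[of y] True y by auto
    ultimately have \<tau>: "\<tau> \<longlonglongrightarrow> t / sqrt (-2 * (y + ln (1 - y)))"
      unfolding \<tau>_def by (intro tendsto_intros) auto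
    have "\<kappa> \<longlonglongrightarrow> 0"
    proof -
      have "(\<lambda>n. (1 / (real n - 1)) / (1 - x n)) \<longlonglongrightarrow> 0 / (1 - y)"
        by (intro tendsto_divide tendsto_diff tendsto_const xlim) (use True in \<open>auto, real_asymp\<close>)
      moreover have "\<forall>\<^sub>F n in sequentially. (1 / (real n - 1)) / (1 - x n) = \<kappa> n"
        using dim
      proof eventually_elim
        case (elim n)
        then have "1 - x n = (real n - 1 - real (p n)) / (real n - 1)"
          by (simp add: x_def diff_divide_distrib)
        then show ?case using elim by (simp add: \<kappa>_def)
      qed
      ultimately show ?thesis using Lim_transform_eventually by fastforce
    qed
    then have "(\<lambda>n. \<bar>\<tau> n\<bar> ^ k * \<kappa> n) \<longlonglongrightarrow> \<bar>t / sqrt (-2 * (y + ln (1 - y)))\<bar> ^ k * 0"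
      by (intro tendsto_intros \<tau>)
    then show ?thesis by simp
  next
    case False
    then have "y = 1" using y by simp
    have "filterlim (\<lambda>n. 1 - x n) (at_right 0) sequentially"
      using tendsto_diff[OF tendsto_const[of 1] xlim] x01 unfolding filterlim_at \<open>y = 1\<close>
      by (auto elim: eventually_mono)
    then have "filterlim (\<lambda>n. ln (1 - x n)) at_bot sequentially"
      by (rule filterlim_compose[OF ln_at_0])
    then have "filterlim (\<lambda>n. - ln (1 - x n)) at_top sequentially"
      by (simp add: filterlim_uminus_at_bot)
    then have "filterlim (\<lambda>n. 2 * (- x n + - ln (1 - x n))) at_top sequentially"
      by (intro filterlim_tendsto_pos_mult_at_top[OF tendsto_const] filterlim_tendsto_add_at_top[OF tendsto_minus[OF xlim]]) auto
    then have "filterlim (\<lambda>n. sigma_sq_n n (p n)) at_top sequentially"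
      by (simp add: sig algebra_simps)
    then have "filterlim (\<lambda>n. sqrt (sigma_sq_n n (p n))) at_top sequentially"
      by (rule filterlim_compose[OF sqrt_at_top])
    then have "\<tau> \<longlonglongrightarrow> 0"
      unfolding \<tau>_def by (intro tendsto_divide_0[OF tendsto_const] filterlim_at_top_imp_at_infinity)
    then have "(\<lambda>n. \<bar>\<tau> n\<bar> ^ k) \<longlonglongrightarrow> \<bar>0\<bar> ^ k" by (intro tendsto_intros)
    moreover have "\<bar>0::real\<bar> ^ k = 0" using k by simp
    ultimately have t0: "(\<lambda>n. \<bar>\<tau> n\<bar> ^ k) \<longlonglongrightarrow> 0" by (simp only:)
    show ?thesis
    proof (rule Lim_null_comparison[OF _ t0])
      show "\<forall>\<^sub>F n in sequentially. norm (\<bar>\<tau> n\<bar> ^ k * \<kappa> n) \<le> \<bar>\<tau> n\<bar> ^ k"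
        using \<kappa> by eventually_elim (simp add: abs_mult mult_left_le)
    qed
  qed
  have "(\<lambda>n. \<bar>\<tau> n\<bar> ^ 1 * \<kappa> n + \<bar>\<tau> n\<bar> ^ 2 * \<kappa> n + \<bar>\<tau> n\<bar> ^ 3 * \<kappa> n) \<longlonglongrightarrow> 0 + 0 + 0"
    by (intro tendsto_add key) auto
  then show "(\<lambda>n. (\<bar>\<tau> n\<bar> + (\<tau> n)^2 + \<bar>\<tau> n\<bar>^3) / (real n - 1 - real (p n))) \<longlonglongrightarrow> 0"
    by (simp add: \<kappa>_def add_divide_distrib)
  have "\<forall>\<^sub>F n in sequentially. \<bar>\<tau> n\<bar> ^ 1 * \<kappa> n < 1/4"
    by (rule order_tendstoD(2)[OF key]) auto
  then show "\<forall>\<^sub>F n in sequentially. 4 * \<bar>\<tau> n\<bar> \<le> real n - 1 - real (p n)"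
    using dim by eventually_elim (auto simp: \<kappa>_def field_simps)
qed

section \<open>The determinant of a correlation matrix\<close>

lemma sum_delta_mult:
  fixes f :: "nat \<Rightarrow> real"
  assumes "i < n"
  shows "(\<Sum>k<n. (if k = i then 1 else 0) * f k) = f i" "(\<Sum>k<n. (if i = k then 1 else 0) * f k) = f i"
proof -
  have "(if k = i then 1 else 0) * f k = (if k = i then f k else 0)"
    "(if i = k then 1 else 0) * f k = (if k = i then f k else 0)" for k by auto
  then show "(\<Sum>k<n. (if k = i then 1 else 0) * f k) = f i" "(\<Sum>k<n. (if i = k then 1 else 0) * f k) = f i"
    using assms by (simp_all only: sum.delta finite_lessThan lessThan_iff if_True)
qed

text \<open>Expanding and summing over \<open>l\<close> first leaves the orthonormality of the
  columns, the form in which \<open>orth_nat\<close> is stated.\<close>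

lemma orth_nat_inner:
  assumes "orth_nat n Q"
  shows "(\<Sum>l<n. (\<Sum>i<n. Q l i * x i) * (\<Sum>i<n. Q l i * y i)) = (\<Sum>i<n. x i * y i)"
proof -
  have "(\<Sum>l<n. (\<Sum>i<n. Q l i * x i) * (\<Sum>i<n. Q l i * y i))
      = (\<Sum>l<n. \<Sum>i<n. \<Sum>j<n. x i * (y j * (Q l i * Q l j)))"
    by (simp add: sum_product mult_ac)
  also have "\<dots> = (\<Sum>i<n. \<Sum>l<n. \<Sum>j<n. x i * (y j * (Q l i * Q l j)))" by (rule sum.swap)
  also have "\<dots> = (\<Sum>i<n. \<Sum>j<n. \<Sum>l<n. x i * (y j * (Q l i * Q l j)))"
    by (intro sum.cong refl sum.swap)
  also have "\<dots> = (\<Sum>i<n. \<Sum>j<n. x i * (y j * (if i = j then 1 else 0)))"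
    using assms by (intro sum.cong refl) (simp add: orth_nat_def sum_distrib_left[symmetric])
  also have "\<dots> = (\<Sum>i<n. x i * y i)"
    by (intro sum.cong refl) (simp add: if_distrib sum.delta cong: if_cong)
  finally show ?thesis .
qed

lemma orth_nat_id: "orth_nat n (\<lambda>i j. if i = j then 1 else 0)"
  unfolding orth_nat_def by (intro allI impI) (simp only: sum_delta_mult)

lemma orth_nat_compose:
  assumes "orth_nat n H" "orth_nat n Q"
  shows "orth_nat n (\<lambda>i j. \<Sum>k<n. H i k * Q k j)"
  unfolding orth_nat_def
proof (intro allI impI)
  fix i j assume "i < n" "j < n"
  have "(\<Sum>l<n. (\<Sum>k<n. H l k * Q k i) * (\<Sum>k<n. H l k * Q k j)) = (\<Sum>k<n. Q k i * Q k j)"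
    by (rule orth_nat_inner[OF assms(1)])
  then show "(\<Sum>l<n. (\<Sum>k<n. H l k * Q k i) * (\<Sum>k<n. H l k * Q k j)) = (if i = j then 1 else 0)"
    using assms(2) \<open>i < n\<close> \<open>j < n\<close> by (simp add: orth_nat_def)
qed

lemma compose_apply:
  fixes H Q :: "nat \<Rightarrow> nat \<Rightarrow> real"
  shows "(\<Sum>j<n. (\<Sum>k<n. H i k * Q k j) * x j) = (\<Sum>k<n. H i k * (\<Sum>j<n. Q k j * x j))"
proof -
  have "(\<Sum>j<n. (\<Sum>k<n. H i k * Q k j) * x j) = (\<Sum>j<n. \<Sum>k<n. H i k * Q k j * x j)"
    by (simp add: sum_distrib_right)
  also have "\<dots> = (\<Sum>k<n. \<Sum>j<n. H i k * Q k j * x j)" by (rule sum.swap)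
  finally show ?thesis by (simp add: sum_distrib_left mult_ac)
qed

lemma orth_nat_reflection:
  fixes w :: "nat \<Rightarrow> real"
  shows "orth_nat n (\<lambda>i j. (if i = j then 1 else 0) - 2 / (\<Sum>k<n. (w k)^2) * w i * w j)"
  unfolding orth_nat_def
proof (intro allI impI)
  fix i j assume ij: "i < n" "j < n"
  define S where "S = (\<Sum>k<n. (w k)^2)"
  define c where "c = 2 / S"
  \<comment> \<open>This also holds for \<open>S = 0\<close>, where \<open>c = 0\<close> by division
    by zero; the reflection is then the identity.\<close>
  have cS: "c * c * S = 2 * c" by (simp add: c_def)
  have "(\<Sum>k<n. ((if k = i then 1 else 0) - c * w k * w i) * ((if k = j then 1 else 0) - c * w k * w j))
     = (\<Sum>k<n. (if k = i then 1 else 0) * (if k = j then 1 else 0)) - (\<Sum>k<n. (if k = i then 1 else 0) * (c * w k * w j))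
       - (\<Sum>k<n. (if k = j then 1 else 0) * (c * w k * w i)) + (\<Sum>k<n. c * c * w i * w j * (w k)^2)"
    unfolding sum_subtractf[symmetric] sum.distrib[symmetric]
    by (intro sum.cong refl) (simp only: algebra_simps power2_eq_square)
  also have "\<dots> = (if i = j then 1 else 0) - c * w i * w j - c * w j * w i + c * c * S * w i * w j"
    unfolding sum_delta_mult(1)[OF ij(1)] sum_delta_mult(1)[OF ij(2)] sum_distrib_left[symmetric] S_def[symmetric]
    by simp
  also have "\<dots> = (if i = j then 1 else 0)" unfolding cS by simp
  finally show "(\<Sum>k<n. ((if k = i then 1 else 0) - 2 / (\<Sum>k<n. (w k)^2) * w k * w i) * ((if k = j then 1 else 0) - 2 / (\<Sum>k<n. (w k)^2) * w k * w j))
     = (if i = j then 1 else 0)" by (simp only: c_def S_def)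
qed

text \<open>The reflection sends the part of \<open>u\<close> from index \<open>r\<close> on to
  \<open>s\<close> times the unit vector of index \<open>r\<close>, where \<open>s\<close> is its
  length. The normal \<open>w\<close> vanishes below \<open>r\<close>, so the first \<open>r\<close>
  rows are trivial and vectors supported below \<open>r\<close> are fixed; this preserves zeros
  created earlier.\<close>

lemma householder:
  fixes u :: "nat \<Rightarrow> real"
  assumes "r < n"
  obtains H where "orth_nat n H" "\<And>i j. i < r \<Longrightarrow> H i j = (if i = j then 1 else 0)"
    "\<And>x i. i < n \<Longrightarrow> (\<And>l. r \<le> l \<Longrightarrow> l < n \<Longrightarrow> x l = 0) \<Longrightarrow> (\<Sum>j<n. H i j * x j) = x i"
    "\<And>l. r < l \<Longrightarrow> l < n \<Longrightarrow> (\<Sum>j<n. H l j * u j) = 0"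
proof -
  define s where "s = sqrt (\<Sum>i\<in>{r..<n}. (u i)^2)"
  define w where "w = (\<lambda>i. if i < r then 0 else if i = r then u r - s else u i)"
  define S where "S = (\<Sum>k<n. (w k)^2)"
  define H where "H = (\<lambda>i j. (if i = j then 1 else 0) - 2 / S * w i * w j)"
  have s2: "s * s = (u r)^2 + (\<Sum>i\<in>{Suc r..<n}. (u i)^2)"
    using assms by (simp add: s_def sum_nonneg sum.atLeast_Suc_lessThan)
  have split: "(\<Sum>k<n. w k * f k) = (u r - s) * f r + (\<Sum>k\<in>{Suc r..<n}. u k * f k)" for f :: "nat \<Rightarrow> real"
  proof -
    have "(\<Sum>k<n. w k * f k) = (\<Sum>k\<in>{r..<n}. w k * f k)"
      by (rule sum.mono_neutral_right) (auto simp: w_def)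
    also have "\<dots> = w r * f r + (\<Sum>k\<in>{Suc r..<n}. w k * f k)"
      using assms by (rule sum.atLeast_Suc_lessThan)
    finally show ?thesis by (simp add: w_def)
  qed
  have split_w: "(\<Sum>k\<in>{Suc r..<n}. u k * w k) = (\<Sum>k\<in>{Suc r..<n}. (u k)^2)"
    by (intro sum.cong) (auto simp: w_def power2_eq_square)
  \<comment> \<open>The tail of \<open>u\<close> and its image have equal length, which makes the
    squared length of \<open>w\<close> twice its inner product with \<open>u\<close>; the reflection
    therefore subtracts exactly \<open>w\<close> from \<open>u\<close>.\<close>
  have S: "S = 2 * (\<Sum>k<n. w k * u k)"
  proof -
    have "S = (\<Sum>k<n. w k * w k)" by (simp add: S_def power2_eq_square)
    also have "\<dots> = 2 * (\<Sum>k<n. w k * u k)"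
      unfolding split split_w using s2 by (simp add: w_def power2_eq_square algebra_simps)
    finally show ?thesis .
  qed
  have app: "(\<Sum>j<n. H i j * x j) = x i - 2 / S * w i * (\<Sum>j<n. w j * x j)" if "i < n" for i x
    using sum_delta_mult(2)[OF that, of x]
    by (simp add: H_def left_diff_distrib sum_subtractf sum_distrib_left mult.assoc)
  show thesis
  proof (rule that)
    show "orth_nat n H" unfolding H_def S_def by (rule orth_nat_reflection)
    show "H i j = (if i = j then 1 else 0)" if "i < r" for i j
      using that by (simp add: H_def w_def)
    show "(\<Sum>j<n. H i j * x j) = x i" if "i < n" "\<And>l. r \<le> l \<Longrightarrow> l < n \<Longrightarrow> x l = 0" for x i
    proof -
      have "(\<Sum>j<n. w j * x j) = 0"
        using that(2) by (intro sum.neutral) (auto simp: w_def)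
      then show ?thesis unfolding app[OF that(1)] by simp
    qed
    show "(\<Sum>j<n. H l j * u j) = 0" if l: "r < l" "l < n" for l
    proof (cases "S = 0")
      \<comment> \<open>Here \<open>w = 0\<close>: the tail of \<open>u\<close> is already a
        multiple of the unit vector.\<close>
      case True
      then have "w l = 0" using l by (simp add: S_def sum_nonneg_eq_0_iff)
      then show ?thesis using True l unfolding app[OF l(2)] by (simp add: w_def)
    next
      case False
      then show ?thesis using l unfolding app[OF l(2)] S by (simp add: w_def)
    qed
  qed
qed

section \<open>Triangularisation of the data\<close>

text \<open>The transpose of \<open>Q\<close> is the orthogonal factor of a QR decomposition of
  \<open>x 0\<close>, ..., \<open>x (k - 1)\<close>. In the applications \<open>x 0\<close> is the
  all-ones vector, prepended by \<open>case_nat\<close>.\<close>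

definition triangulates :: "nat \<Rightarrow> nat \<Rightarrow> (nat \<Rightarrow> nat \<Rightarrow> real) \<Rightarrow> (nat \<Rightarrow> nat \<Rightarrow> real) \<Rightarrow> bool" where
  "triangulates n k Q x \<longleftrightarrow> orth_nat n Q \<and> (\<forall>j<k. \<forall>l. j < l \<longrightarrow> l < n \<longrightarrow> (\<Sum>i<n. Q l i * x j i) = 0)"

text \<open>One reflection applied to the image of \<open>x k\<close>. Keeping the rows below
  \<open>k\<close> ensures that those coordinates do not change when the new vector is taken into
  account.\<close>

lemma triangulates_Suc:
  assumes "triangulates n k Q x" "k < n"
  obtains Q' where "triangulates n (Suc k) Q' x" "\<And>l i. l < k \<Longrightarrow> i < n \<Longrightarrow> Q' l i = Q l i"
proof -
  obtain H where H: "orth_nat n H" "\<And>i j. i < k \<Longrightarrow> H i j = (if i = j then 1 else 0)"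
    "\<And>x i. i < n \<Longrightarrow> (\<And>l. k \<le> l \<Longrightarrow> l < n \<Longrightarrow> x l = 0) \<Longrightarrow> (\<Sum>j<n. H i j * x j) = x i"
    "\<And>l. k < l \<Longrightarrow> l < n \<Longrightarrow> (\<Sum>j<n. H l j * (\<Sum>i<n. Q j i * x k i)) = 0"
    by (rule householder[OF assms(2), of "\<lambda>j. \<Sum>i<n. Q j i * x k i"]) blast
  define Q' where "Q' = (\<lambda>i j. \<Sum>k<n. H i k * Q k j)"
  have "(\<Sum>i<n. Q' l i * x j i) = 0" if "j < Suc k" "j < l" "l < n" for j l
  proof (cases "j = k")
    case True then show ?thesis using H(4) that by (simp add: Q'_def compose_apply)
  next
    case False
    then have z: "(\<Sum>i<n. Q l i * x j i) = 0" if "j < l" "l < n" for l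
      using assms(1) that \<open>j < Suc k\<close> by (simp add: triangulates_def)
    have "(\<Sum>i<n. Q' l i * x j i) = (\<Sum>i<n. Q l i * x j i)"
      unfolding Q'_def compose_apply
      by (rule H(3)[OF \<open>l < n\<close>, where x = "\<lambda>l. \<Sum>i<n. Q l i * x j i"]) (use z that False in auto)
    then show ?thesis using z that by simp
  qed
  moreover have "orth_nat n Q'"
    unfolding Q'_def using assms(1) H(1) by (intro orth_nat_compose) (simp_all add: triangulates_def)
  ultimately have "triangulates n (Suc k) Q' x" unfolding triangulates_def by blast
  moreover have "Q' l i = Q l i" if "l < k" "i < n" for l i
    using that assms(2) by (simp add: Q'_def H(2) sum_delta_mult)
  ultimately show thesis by (rule that)
qed

lemma triangulates_exists:
  assumes "k \<le> n"
  shows "\<exists>Q. triangulates n k Q x"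
  using assms
proof (induction k)
  case 0 show ?case using orth_nat_id by (auto simp: triangulates_def)
next
  case (Suc k)
  then obtain Q where "triangulates n k Q x" by auto
  then show ?case using triangulates_Suc Suc.prems by (metis Suc_le_lessD)
qed

section \<open>The correlation determinant as a product\<close>

text \<open>\<open>Q\<close> sends the all-ones vector to a multiple of the unit vector of index 0,
  so centring amounts to deleting coordinate 0.\<close>

lemma centered_inner_orth:
  assumes n: "0 < n" and Q: "triangulates n 1 Q (\<lambda>_ _. 1)"
  shows "(\<Sum>i<n. (x i - vmean n x) * (y i - vmean n y))
       = (\<Sum>l\<in>{1..<n}. (\<Sum>i<n. Q l i * x i) * (\<Sum>i<n. Q l i * y i))"
proof -
  \<comment> \<open>The multiple in question; its square is \<open>n\<close> because
    \<open>Q\<close> preserves inner products.\<close>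
  define c where "c = (\<Sum>i<n. Q 0 i)"
  have z: "(\<Sum>i<n. Q l i) = 0" if "0 < l" "l < n" for l
    using Q that by (auto simp: triangulates_def)
  have orth: "orth_nat n Q" using Q by (simp add: triangulates_def)
  have range: "{..<n} = insert 0 {1..<n}" using n by auto
  have split: "(\<Sum>l<n. f l) = f 0 + (\<Sum>l\<in>{1..<n}. f l)" for f :: "nat \<Rightarrow> real"
    unfolding range by simp
  have sum1: "(\<Sum>i<n. v i) = c * (\<Sum>i<n. Q 0 i * v i)" for v
    using orth_nat_inner[OF orth, of "\<lambda>_. 1" v] z
    by (subst (asm) split) (simp add: c_def)
  have c2: "c * c = real n" using sum1[of "\<lambda>_. 1"] by (simp add: c_def)
  have "(\<Sum>i<n. (x i - vmean n x) * (y i - vmean n y))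
      = (\<Sum>i<n. x i * y i) - vmean n y * (\<Sum>i<n. x i) - vmean n x * (\<Sum>i<n. y i) + real n * (vmean n x * vmean n y)"
    by (simp add: algebra_simps sum.distrib sum_subtractf sum_distrib_left sum_distrib_right)
  also have "\<dots> = (\<Sum>i<n. x i * y i) - (\<Sum>i<n. x i) * (\<Sum>i<n. y i) / real n"
    using n by (simp add: vmean_def)
  also have "(\<Sum>i<n. x i) * (\<Sum>i<n. y i) / real n = (\<Sum>i<n. Q 0 i * x i) * (\<Sum>i<n. Q 0 i * y i)"
  proof -
    have "(\<Sum>i<n. x i) * (\<Sum>i<n. y i) = (c * c) * ((\<Sum>i<n. Q 0 i * x i) * (\<Sum>i<n. Q 0 i * y i))"
      unfolding sum1[of x] sum1[of y] by (simp add: mult_ac)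
    then show ?thesis unfolding c2 using n by simp
  qed
  also have "(\<Sum>i<n. x i * y i) = (\<Sum>l<n. (\<Sum>i<n. Q l i * x i) * (\<Sum>i<n. Q l i * y i))"
    by (rule orth_nat_inner[OF orth, symmetric])
  finally show ?thesis by (subst (asm) (3) split) simp
qed

text \<open>A degenerate column makes both sides vanish through \<open>x / 0 = 0\<close>.\<close>

lemma det_corr_mat_triangular:
  assumes pn: "p < n"
    and Q: "triangulates n (Suc p) Q (case_nat (\<lambda>_. 1) Y)"
  shows "det (corr_mat n p Y)
       = (\<Prod>i<p. (\<Sum>k<n. Q (Suc i) k * Y i k)^2 / (\<Sum>l\<in>{1..<n}. (\<Sum>k<n. Q l k * Y i k)^2))"
proof -
  define q where "q = (\<lambda>i l. \<Sum>k<n. Q l k * Y i k)"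
  define S where "S = (\<lambda>i. \<Sum>l\<in>{1..<n}. (q i l)^2)"
  \<comment> \<open>Column \<open>i\<close> of \<open>T\<close> is the normalised image of the
    centred \<open>Y i\<close>, and \<open>Suc\<close> skips the deleted coordinate 0. The
    correlation matrix is the transpose of \<open>T\<close> times \<open>T\<close>, and
    \<open>T\<close> is upper triangular, so its determinant is the squared product of the diagonal
    of \<open>T\<close>.\<close>
  define T where "T = mat p p (\<lambda>(l, i). q i (Suc l) / sqrt (S i))"
  have T: "T \<in> carrier_mat p p" by (simp add: T_def)
  have Q1: "triangulates n 1 Q (\<lambda>_ _. 1)" using Q by (auto simp: triangulates_def)
  have z: "q i l = 0" if "i < p" "Suc i < l" "l < n" for i l
  proof -
    have "\<forall>j<Suc p. \<forall>l. j < l \<longrightarrow> l < n \<longrightarrow> (\<Sum>k<n. Q l k * case_nat (\<lambda>_. 1) Y j k) = 0"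
      using Q by (simp add: triangulates_def)
    from this[rule_format, of "Suc i" l] that show ?thesis by (simp add: q_def)
  qed
  have inner: "(\<Sum>k<n. (Y i k - vmean n (Y i)) * (Y j k - vmean n (Y j))) = (\<Sum>l\<in>{1..<n}. q i l * q j l)" for i j
    unfolding q_def using pn by (intro centered_inner_orth Q1) simp
  have norm: "(\<Sum>k<n. (Y i k - vmean n (Y i))^2) = S i" for i
    using inner[of i i] by (simp add: power2_eq_square S_def)
  have "pearson n (Y i) (Y j) = (\<Sum>l<p. (q i (Suc l) / sqrt (S i)) * (q j (Suc l) / sqrt (S j)))" if "i < p" "j < p" for i j
  proof -
    have "(\<Sum>l\<in>{1..<n}. q i l * q j l) = (\<Sum>l\<in>{1..<Suc p}. q i l * q j l)"
      using pn that by (intro sum.mono_neutral_right) (auto intro!: z)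
    also have "\<dots> = (\<Sum>l<p. q i (Suc l) * q j (Suc l))"
      by (simp only: One_nat_def sum.shift_bounds_Suc_ivl lessThan_atLeast0)
    finally show ?thesis
      unfolding pearson_def norm inner by (simp add: real_sqrt_mult sum_divide_distrib)
  qed
  then have "corr_mat n p Y = transpose_mat T * T"
    by (intro eq_matI) (auto simp: corr_mat_def T_def scalar_prod_def lessThan_atLeast0)
  then have "det (corr_mat n p Y) = det T * det T"
    using T by (simp add: det_mult[of _ p] det_transpose[of _ p])
  also have "det T = (\<Prod>i<p. q i (Suc i) / sqrt (S i))"
  proof -
    have "upper_triangular T" by (auto simp: upper_triangular_def T_def intro!: z) (use pn in auto)
    then have "det T = prod_list (diag_mat T)" using T by (rule det_upper_triangular)
    also have "\<dots> = (\<Prod>i<p. T $$ (i,i))" using T by (simp add: prod_list_diag_prod lessThan_atLeast0)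
    finally show ?thesis by (simp add: T_def)
  qed
  also have "(\<Prod>i<p. q i (Suc i) / sqrt (S i)) * (\<Prod>i<p. q i (Suc i) / sqrt (S i)) = (\<Prod>i<p. (q i (Suc i))^2 / S i)"
    unfolding prod.distrib[symmetric]
    by (intro prod.cong refl) (simp add: power2_eq_square S_def sum_nonneg)
  finally show ?thesis by (simp add: q_def S_def)
qed

text \<open>\<open>Q\<close> triangularises the all-ones vector and the first \<open>k\<close>
  columns, so it is fixed before \<open>y\<close>; the numerator is what remains of \<open>y\<close>
  after these k + 1 directions. The order of the quantifiers later allows sphericity to be applied
  to \<open>y\<close> with \<open>Q\<close> constant.\<close>

lemma det_corr_mat_step:
  assumes k: "Suc k < n"
  shows "\<exists>Q. orth_nat n Q \<and> (\<forall>y. det (corr_mat n (Suc k) (Y(k := y))) = det (corr_mat n k Y) *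
     ((\<Sum>l\<in>{Suc k..<n}. (mat_app n Q y l)^2) / (\<Sum>l\<in>{1..<n}. (mat_app n Q y l)^2)))"
proof -
  obtain Q where Q: "triangulates n (Suc k) Q (case_nat (\<lambda>_. 1) Y)"
    using triangulates_exists[of "Suc k" n] k by (metis less_imp_le)
  then have orth: "orth_nat n Q" by (simp add: triangulates_def)
  have "det (corr_mat n (Suc k) (Y(k := y))) = det (corr_mat n k Y) *
     ((\<Sum>l\<in>{Suc k..<n}. (mat_app n Q y l)^2) / (\<Sum>l\<in>{1..<n}. (mat_app n Q y l)^2))" for y
  proof -
    have "triangulates n (Suc k) Q (case_nat (\<lambda>_. 1) (Y(k := y)))"
      unfolding triangulates_def
    proof (intro conjI orth allI impI)
      fix j l assume "j < Suc k" "j < l" "l < n"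
      then have "(\<Sum>i<n. Q l i * case_nat (\<lambda>_. 1) Y j i) = 0" using Q by (auto simp: triangulates_def)
      then show "(\<Sum>i<n. Q l i * case_nat (\<lambda>_. 1) (Y(k := y)) j i) = 0"
        using \<open>j < Suc k\<close> by (cases j) auto
    qed
    then obtain Q' where Q': "triangulates n (Suc (Suc k)) Q' (case_nat (\<lambda>_. 1) (Y(k := y)))"
      and agree: "\<And>l i. l < Suc k \<Longrightarrow> i < n \<Longrightarrow> Q' l i = Q l i"
      using triangulates_Suc k by metis
    have orth': "orth_nat n Q'" using Q' by (simp add: triangulates_def)
    define q where "q = (\<lambda>l. \<Sum>i<n. Q l i * y i)"
    define q' where "q' = (\<lambda>l. \<Sum>i<n. Q' l i * y i)"
    have z: "q' l = 0" if "Suc k < l" "l < n" for l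
    proof -
      have "\<forall>j<Suc (Suc k). \<forall>l. j < l \<longrightarrow> l < n \<longrightarrow> (\<Sum>i<n. Q' l i * case_nat (\<lambda>_. 1) (Y(k := y)) j i) = 0"
        using Q' by (simp add: triangulates_def)
      from this[rule_format, of "Suc k" l] that show ?thesis by (simp add: q'_def)
    qed
    have qq: "q' l = q l" if "l < Suc k" for l using agree that by (simp add: q_def q'_def)
    \<comment> \<open>Passing from \<open>Q\<close> to \<open>Q'\<close> preserves the total length
      and the first \<open>Suc k\<close> coordinates, hence these tail sums; in the tail from
      \<open>Suc k\<close> on, \<open>Q'\<close> leaves at most one nonzero coordinate.\<close>
    have tail: "(\<Sum>l\<in>{m..<n}. (q' l)^2) = (\<Sum>l\<in>{m..<n}. (q l)^2)" if "m \<le> Suc k" for m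
    proof -
      have "(\<Sum>l<n. (q' l)^2) = (\<Sum>l<n. (q l)^2)"
        using orth_nat_inner[OF orth, of y y] orth_nat_inner[OF orth', of y y]
        by (simp add: q_def q'_def power2_eq_square)
      moreover have "(\<Sum>l<n. f l) = (\<Sum>l<m. f l) + (\<Sum>l\<in>{m..<n}. f l)" for f :: "nat \<Rightarrow> real"
        using that k by (metis sum.atLeastLessThan_concat lessThan_atLeast0 le0 less_imp_le order_trans)
      moreover have "(\<Sum>l<m. (q' l)^2) = (\<Sum>l<m. (q l)^2)"
        using that qq by (intro sum.cong) auto
      ultimately show ?thesis by simp
    qed
    have last: "(\<Sum>l\<in>{Suc k..<n}. (q' l)^2) = (q' (Suc k))^2"
      using k z by (simp add: sum.atLeast_Suc_lessThan)
    have app: "(\<Sum>l\<in>{m..<n}. (mat_app n Q y l)^2) = (\<Sum>l\<in>{m..<n}. (q l)^2)" for m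
      by (intro sum.cong) (auto simp: mat_app_def q_def)
    \<comment> \<open>One and the same \<open>Q'\<close> expands both determinants, so that the
      first \<open>k\<close> factors agree.\<close>
    have "triangulates n (Suc k) Q' (case_nat (\<lambda>_. 1) (Y(k := y)))"
      using Q' unfolding triangulates_def by (meson less_Suc_eq)
    then have "det (corr_mat n k (Y(k := y)))
       = (\<Prod>i<k. (\<Sum>j<n. Q' (Suc i) j * (Y(k:=y)) i j)^2 / (\<Sum>l\<in>{1..<n}. (\<Sum>j<n. Q' l j * (Y(k:=y)) i j)^2))"
      by (rule det_corr_mat_triangular[rotated]) (use k in simp)
    moreover have "det (corr_mat n (Suc k) (Y(k := y)))
       = (\<Prod>i<Suc k. (\<Sum>j<n. Q' (Suc i) j * (Y(k:=y)) i j)^2 / (\<Sum>l\<in>{1..<n}. (\<Sum>j<n. Q' l j * (Y(k:=y)) i j)^2))"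
      using k Q' by (intro det_corr_mat_triangular)
    moreover have "corr_mat n k (Y(k := y)) = corr_mat n k Y"
      by (intro eq_matI) (auto simp: corr_mat_def)
    ultimately have "det (corr_mat n (Suc k) (Y(k := y))) = det (corr_mat n k Y) * ((q' (Suc k))^2 / (\<Sum>l\<in>{1..<n}. (q' l)^2))"
      by (simp add: q'_def)
    then show ?thesis unfolding app last[symmetric] using tail[of 1] tail[of "Suc k"] by simp
  qed
  then show ?thesis using orth by blast
qed

section \<open>Spherical laws\<close>

text \<open>The normal (sin (\<theta>/2), -cos (\<theta>/2)) and the half-angle formulas give these
  coordinates. A reflection can be differentiated in \<theta> as well as a rotation and comes from
  \<open>orth_nat_reflection\<close>; at \<theta> = 0 it flips the sign of coordinate
  \<open>l\<close>.\<close>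

lemma plane_reflection:
  fixes \<theta> :: real
  assumes kl: "k < n" "l < n" "k \<noteq> l"
  obtains H where "orth_nat n H"
    "\<And>x. mat_app n H x k = cos \<theta> * x k + sin \<theta> * x l"
    "\<And>x. mat_app n H x l = sin \<theta> * x k - cos \<theta> * x l"
    "\<And>x i. i < n \<Longrightarrow> i \<noteq> k \<Longrightarrow> i \<noteq> l \<Longrightarrow> mat_app n H x i = x i"
proof -
  define w where "w = (\<lambda>i. if i = k then sin (\<theta>/2) else if i = l then - cos (\<theta>/2) else 0)"
  define H where "H = (\<lambda>i j. (if i = j then 1 else 0) - 2 / (\<Sum>k<n. (w k)^2) * w i * w j)"
  have wsum: "(\<Sum>i<n. w i * f i) = sin (\<theta>/2) * f k - cos (\<theta>/2) * f l" for f :: "nat \<Rightarrow> real"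
  proof -
    have "(\<Sum>i<n. w i * f i) = (\<Sum>i\<in>{k, l}. w i * f i)"
      using kl by (intro sum.mono_neutral_right) (auto simp: w_def)
    then show ?thesis using kl by (simp add: w_def)
  qed
  have "(\<Sum>i<n. (w i)^2) = 1"
    using wsum[of w] kl sin_cos_squared_add[of "\<theta>/2"] by (simp add: power2_eq_square w_def)
  then have H: "H i j = (if i = j then 1 else 0) - 2 * w i * w j" for i j by (simp add: H_def)
  have app: "mat_app n H x i = x i - 2 * w i * (sin (\<theta>/2) * x k - cos (\<theta>/2) * x l)" if "i < n" for x i
    using sum_delta_mult(2)[OF that, of x] that unfolding wsum[symmetric]
    by (simp add: mat_app_def H left_diff_distrib sum_subtractf sum_distrib_left mult.assoc)
  have c: "cos \<theta> = 1 - 2 * (sin (\<theta>/2))^2" "cos \<theta> = 2 * (cos (\<theta>/2))^2 - 1" "sin \<theta> = 2 * sin (\<theta>/2) * cos (\<theta>/2)"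
    using cos_double_sin[of "\<theta>/2"] cos_double_cos[of "\<theta>/2"] sin_double[of "\<theta>/2"] by simp_all
  show thesis
  proof (rule that)
    show "orth_nat n H" unfolding H_def by (rule orth_nat_reflection)
    show "mat_app n H x k = cos \<theta> * x k + sin \<theta> * x l" for x
      unfolding app[OF kl(1)] c(1) c(3) by (simp add: w_def algebra_simps power2_eq_square)
    show "mat_app n H x l = sin \<theta> * x k - cos \<theta> * x l" for x
      unfolding app[OF kl(2)] c(2) c(3) using kl by (simp add: w_def algebra_simps power2_eq_square)
    show "mat_app n H x i = x i" if "i < n" "i \<noteq> k" "i \<noteq> l" for x i
      unfolding app[OF that(1)] using that by (simp add: w_def)
  qed
qed

lemma measurable_mat_app [measurable]: "mat_app n Q \<in> vec_space n \<rightarrow>\<^sub>M vec_space n"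
  unfolding mat_app_def by measurable

definition sumsq :: "nat set \<Rightarrow> (nat \<Rightarrow> real) \<Rightarrow> real" where
  "sumsq A x = (\<Sum>i\<in>A. (x i)^2)"

lemma sumsq_nonneg [simp]: "0 \<le> sumsq A x"
  by (simp add: sumsq_def sum_nonneg)

lemma sumsq_mono: "finite D \<Longrightarrow> A \<subseteq> D \<Longrightarrow> sumsq A x \<le> sumsq D x"
  unfolding sumsq_def by (rule sum_mono2) auto

lemma sumsq_measurable [measurable]:
  assumes "A \<subseteq> {..<n}"
  shows "sumsq A \<in> borel_measurable (vec_space n)"
  unfolding sumsq_def
  using assms by (intro borel_measurable_sum borel_measurable_power measurable_component_singleton) auto

definition sumsq_ratio :: "nat set \<Rightarrow> nat set \<Rightarrow> (nat \<Rightarrow> real) \<Rightarrow> real" where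
  "sumsq_ratio A D x = sumsq A x / sumsq D x"

lemma sumsq_ratio_bounds:
  assumes "finite D" "A \<subseteq> D"
  shows "0 \<le> sumsq_ratio A D x" "sumsq_ratio A D x \<le> 1"
  using sumsq_mono[OF assms, of x] by (auto simp: sumsq_ratio_def divide_le_eq_1 order_less_le)

lemma sumsq_ratio_measurable [measurable]:
  assumes "A \<subseteq> {..<n}" "D \<subseteq> {..<n}"
  shows "sumsq_ratio A D \<in> borel_measurable (vec_space n)"
  unfolding sumsq_ratio_def
  using assms by (intro borel_measurable_divide sumsq_measurable)

section \<open>The Stein identity of a spherical law\<close>

text \<open>Sphericity is a property of the law alone; in this form it can be used for a single
  factor of a product measure.\<close>

locale spherical_law = prob_space P for P :: "(nat \<Rightarrow> real) measure" +
  fixes n :: nat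
  assumes sets_P [measurable_cong]: "sets P = sets (vec_space n)"
    and invariant: "orth_nat n Q \<Longrightarrow> distr P (vec_space n) (mat_app n Q) = P"
begin

lemma integral_mat_app:
  fixes f :: "(nat \<Rightarrow> real) \<Rightarrow> complex"
  assumes "orth_nat n Q" and [measurable]: "f \<in> borel_measurable (vec_space n)"
  shows "(\<integral>x. f (mat_app n Q x) \<partial>P) = (\<integral>x. f x \<partial>P)"
proof -
  have "(\<integral>x. f x \<partial>P) = (\<integral>x. f x \<partial>distr P (vec_space n) (mat_app n Q))"
    by (simp add: invariant[OF assms(1)])
  also have "\<dots> = (\<integral>x. f (mat_app n Q x) \<partial>P)"
    by (rule integral_distr) measurable
  finally show ?thesis by simp
qed

text \<open>The expectation of \<open>f (mat_app n (H \<theta>) x)\<close> is constant in \<theta>,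
  and \<open>g\<close> is the derivative of the integrand at \<theta> = 0. Mixing a coordinate
  inside \<open>A\<close> with one in \<open>D - A\<close> changes \<open>sumsq A\<close> but not
  \<open>sumsq D\<close>. Without the factor \<open>x k * x l\<close> in \<open>f\<close> the
  derivative would be odd in \<open>x k\<close>, and the identity trivial by symmetry.\<close>

lemma stein_pair:
  fixes h h' :: "real \<Rightarrow> complex"
  assumes D: "D \<subseteq> {..<n}" and A: "A \<subseteq> D"
    and pos: "AE x in P. 0 < sumsq D x"
    and h: "\<And>u. 0 \<le> u \<Longrightarrow> u \<le> 1 \<Longrightarrow> (h has_vector_derivative h' u) (at u)"
    and bd: "\<And>u. 0 \<le> u \<Longrightarrow> u \<le> 1 \<Longrightarrow> norm (h u) \<le> C" "\<And>u. 0 \<le> u \<Longrightarrow> u \<le> 1 \<Longrightarrow> norm (h' u) \<le> C"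
    and [measurable]: "h \<in> borel_measurable borel" "h' \<in> borel_measurable borel"
    and k: "k \<in> A" and l: "l \<in> D - A"
  defines "g \<equiv> \<lambda>x. of_real (((x k)^2 - (x l)^2) / sumsq D x) * h (sumsq A x / sumsq D x)
                    - 2 * of_real ((x k)^2 * (x l)^2 / (sumsq D x)^2) * h' (sumsq A x / sumsq D x)"
  shows "integrable P g" "(\<integral>x. g x \<partial>P) = 0"
proof -
  have finite_D: "finite D" using D finite_subset by auto
  have A': "A \<subseteq> {..<n}" using A D by auto
  have finA: "finite A" using A' finite_subset by auto
  have kl: "k < n" "l < n" "k \<noteq> l" "k \<in> D" using k l A D by auto
  have C0: "C \<ge> 0" using order_trans[OF norm_ge_zero bd(1)[of 0]] by simp
  note [measurable] = sumsq_measurable[OF D] sumsq_measurable[OF A']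
  have [measurable]: "(\<lambda>x. x k) \<in> borel_measurable (vec_space n)" "(\<lambda>x. x l) \<in> borel_measurable (vec_space n)"
    using kl by (auto intro: measurable_component_singleton)
  define f where "f = (\<lambda>x. of_real (x k * x l / sumsq D x) * h (sumsq A x / sumsq D x))"
  have [measurable]: "f \<in> borel_measurable (vec_space n)" unfolding f_def by measurable
  have "\<exists>H. \<forall>\<theta>. orth_nat n (H \<theta>) \<and> (\<forall>x. mat_app n (H \<theta>) x k = cos \<theta> * x k + sin \<theta> * x l)
     \<and> (\<forall>x. mat_app n (H \<theta>) x l = sin \<theta> * x k - cos \<theta> * x l)
     \<and> (\<forall>x i. i < n \<longrightarrow> i \<noteq> k \<longrightarrow> i \<noteq> l \<longrightarrow> mat_app n (H \<theta>) x i = x i)"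
    by (rule choice, rule allI, rule plane_reflection[OF kl(1-3)]) blast
  then obtain H where H: "\<And>\<theta>. orth_nat n (H \<theta>)"
    "\<And>\<theta> x. mat_app n (H \<theta>) x k = cos \<theta> * x k + sin \<theta> * x l"
    "\<And>\<theta> x. mat_app n (H \<theta>) x l = sin \<theta> * x k - cos \<theta> * x l"
    "\<And>\<theta> x i. i < n \<Longrightarrow> i \<noteq> k \<Longrightarrow> i \<noteq> l \<Longrightarrow> mat_app n (H \<theta>) x i = x i"
    by blast
  \<comment> \<open>The derivative is bounded by C + 2 C uniformly in \<theta>, so the same constant
    dominates all difference quotients.\<close>
  define B where "B = 3 * C"
  have main: "((\<lambda>\<theta>. f (mat_app n (H \<theta>) x)) has_vector_derivative g x) (at 0)
      \<and> (\<forall>\<theta>. norm (f (mat_app n (H \<theta>) x) - f (mat_app n (H 0) x)) \<le> B * norm \<theta>) \<and> norm (g x) \<le> B"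
    if S: "0 < sumsq D x" for x
  proof -
    define S where "S = sumsq D x"
    define \<kappa> where "\<kappa> = (\<lambda>\<theta>. cos \<theta> * x k + sin \<theta> * x l)"
    define \<eta> where "\<eta> = (\<lambda>\<theta>. sin \<theta> * x k - cos \<theta> * x l)"
    define R where "R = (\<Sum>i\<in>A - {k}. (x i)^2)"
    define U where "U = (\<lambda>\<theta>. (R + (\<kappa> \<theta>)^2) / S)"
    define G where "G = (\<lambda>\<theta>. of_real (((\<kappa> \<theta>)^2 - (\<eta> \<theta>)^2) / S) * h (U \<theta>)
                    - 2 * of_real ((\<kappa> \<theta>)^2 * (\<eta> \<theta>)^2 / S^2) * h' (U \<theta>))"
    have \<kappa>\<eta>: "(\<kappa> \<theta>)^2 + (\<eta> \<theta>)^2 = (x k)^2 + (x l)^2" for \<theta>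
    proof -
      have "(\<kappa> \<theta>)^2 + (\<eta> \<theta>)^2 = ((sin \<theta>)^2 + (cos \<theta>)^2) * ((x k)^2 + (x l)^2)"
      proof -
        have "(c * a + s * b)^2 + (s * a - c * b)^2 = (s^2 + c^2) * (a^2 + b^2)" for a b c s :: real
          by (simp add: power2_eq_square algebra_simps)
        then show ?thesis by (simp only: \<kappa>_def \<eta>_def)
      qed
      then show ?thesis by simp
    qed
    have sA: "sumsq A (mat_app n (H \<theta>) x) = R + (\<kappa> \<theta>)^2" for \<theta>
    proof -
      have "sumsq A (mat_app n (H \<theta>) x) = (\<kappa> \<theta>)^2 + (\<Sum>i\<in>A - {k}. (mat_app n (H \<theta>) x i)^2)"
        unfolding sumsq_def using finA k by (subst sum.remove[of A k]) (auto simp: H(2) \<kappa>_def)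
      also have "(\<Sum>i\<in>A - {k}. (mat_app n (H \<theta>) x i)^2) = R"
        unfolding R_def using A' l by (intro sum.cong refl arg_cong[where f = "\<lambda>u. u^2"] H(4)) auto
      finally show ?thesis by simp
    qed
    have Dsplit: "sumsq D v = (v k)^2 + (v l)^2 + (\<Sum>i\<in>D - {k} - {l}. (v i)^2)" for v
      unfolding sumsq_def using finite_D kl l by (simp add: sum.remove[of D k] sum.remove[of "D - {k}" l])
    have sD: "sumsq D (mat_app n (H \<theta>) x) = S" for \<theta>
    proof -
      have "(\<Sum>i\<in>D - {k} - {l}. (mat_app n (H \<theta>) x i)^2) = (\<Sum>i\<in>D - {k} - {l}. (x i)^2)"
        using D by (intro sum.cong refl arg_cong[where f = "\<lambda>u. u^2"] H(4)) auto
      then show ?thesis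
        using \<kappa>\<eta>[of \<theta>] unfolding S_def Dsplit H(2,3) \<kappa>_def \<eta>_def by simp
    qed
    have fH: "f (mat_app n (H \<theta>) x) = of_real (\<kappa> \<theta> * \<eta> \<theta> / S) * h (U \<theta>)" for \<theta>
      unfolding f_def sA sD U_def H(2,3) \<kappa>_def \<eta>_def ..
    have U01: "0 \<le> U \<theta>" "U \<theta> \<le> 1" for \<theta>
      using sumsq_ratio_bounds[OF finite_D A, of "mat_app n (H \<theta>) x"] unfolding sumsq_ratio_def sA sD U_def by auto
    have le: "(\<kappa> \<theta>)^2 + (\<eta> \<theta>)^2 \<le> S" for \<theta>
      unfolding \<kappa>\<eta> S_def Dsplit by (simp add: sum_nonneg)
    have d\<kappa>: "(\<kappa> has_real_derivative - \<eta> \<theta>) (at \<theta>)" for \<theta>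
      unfolding \<kappa>_def \<eta>_def by (auto intro!: derivative_eq_intros)
    have d\<eta>: "(\<eta> has_real_derivative \<kappa> \<theta>) (at \<theta>)" for \<theta>
      unfolding \<kappa>_def \<eta>_def by (auto intro!: derivative_eq_intros)
    have dU: "(U has_real_derivative - 2 * \<kappa> \<theta> * \<eta> \<theta> / S) (at \<theta>)" for \<theta>
      unfolding U_def using S by (auto intro!: derivative_eq_intros d\<kappa> simp: S_def)
    have dp: "((\<lambda>\<theta>. \<kappa> \<theta> * \<eta> \<theta> / S) has_real_derivative ((\<kappa> \<theta>)^2 - (\<eta> \<theta>)^2) / S) (at \<theta>)" for \<theta>
      using S by (auto intro!: derivative_eq_intros d\<kappa> d\<eta> simp: S_def power2_eq_square)
    have dG: "((\<lambda>\<theta>. f (mat_app n (H \<theta>) x)) has_vector_derivative G \<theta>) (at \<theta>)" for \<theta>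
    proof -
      have 1: "((\<lambda>\<theta>. h (U \<theta>)) has_vector_derivative (- 2 * \<kappa> \<theta> * \<eta> \<theta> / S) *\<^sub>R h' (U \<theta>)) (at \<theta>)"
        using vector_diff_chain_at[where f = U and x = \<theta> and g = h, OF _ h[OF U01[of \<theta>]]] dU[of \<theta>]
        unfolding has_real_derivative_iff_has_vector_derivative o_def by blast
      have 2: "((\<lambda>\<theta>. complex_of_real (\<kappa> \<theta> * \<eta> \<theta> / S)) has_vector_derivative of_real (((\<kappa> \<theta>)^2 - (\<eta> \<theta>)^2) / S)) (at \<theta>)"
        by (rule has_vector_derivative_of_real[OF dp])
      show ?thesis
        unfolding fH
        by (rule has_vector_derivative_eq_rhs[OF has_vector_derivative_mult[OF 2 1]])
           (simp add: G_def scaleR_conv_of_real power2_eq_square)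
    qed
    have nG: "norm (G \<theta>) \<le> B" for \<theta>
    proof -
      have S0: "S > 0" using S by (simp add: S_def)
      have k1: "(\<kappa> \<theta>)^2 \<le> S" "(\<eta> \<theta>)^2 \<le> S" using le[of \<theta>] zero_le_power2[of "\<kappa> \<theta>"] zero_le_power2[of "\<eta> \<theta>"] by linarith+
      have "\<bar>(\<kappa> \<theta>)^2 - (\<eta> \<theta>)^2\<bar> \<le> S"
        using k1 zero_le_power2[of "\<kappa> \<theta>"] zero_le_power2[of "\<eta> \<theta>"] by linarith
      then have a: "\<bar>((\<kappa> \<theta>)^2 - (\<eta> \<theta>)^2) / S\<bar> \<le> 1" using S0 by simp
      have "(\<kappa> \<theta>)^2 * (\<eta> \<theta>)^2 \<le> S * S" using k1 S0 by (intro mult_mono) auto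
      then have b: "\<bar>(\<kappa> \<theta>)^2 * (\<eta> \<theta>)^2 / S^2\<bar> \<le> 1" using S0 by (simp add: power2_eq_square)
      have "norm (G \<theta>) \<le> \<bar>((\<kappa> \<theta>)^2 - (\<eta> \<theta>)^2) / S\<bar> * norm (h (U \<theta>)) + 2 * \<bar>(\<kappa> \<theta>)^2 * (\<eta> \<theta>)^2 / S^2\<bar> * norm (h' (U \<theta>))"
        unfolding G_def by (rule order_trans[OF norm_triangle_ineq4]) (simp only: norm_mult norm_of_real norm_numeral order_refl)
      also have "\<dots> \<le> 1 * C + 2 * 1 * C"
        by (intro add_mono mult_mono a b bd U01 order_refl C0) auto
      finally show ?thesis by (simp add: B_def)
    qed
    have G0: "G 0 = g x"
    proof -
      have "R + (x k)^2 = sumsq A x" unfolding R_def sumsq_def using finA k by (simp add: sum.remove[of A k])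
      then show ?thesis by (simp add: G_def g_def \<kappa>_def \<eta>_def U_def S_def)
    qed
    have "norm (f (mat_app n (H \<theta>) x) - f (mat_app n (H 0) x)) \<le> B * norm (\<theta> - 0)" for \<theta>
      by (rule differentiable_bound[of UNIV _ "\<lambda>\<theta> u. u *\<^sub>R G \<theta>"])
         (use dG nG in \<open>auto simp: has_vector_derivative_def mult.commute[of _ "norm _"] intro!: onorm_le mult_right_mono\<close>)
    then show ?thesis using dG[of 0] nG[of 0] unfolding G0 by auto
  qed
  have gm[measurable]: "g \<in> borel_measurable (vec_space n)" unfolding g_def by measurable
  show int: "integrable P g"
    by (rule integrable_const_bound[of _ B]) (use main pos in \<open>auto elim: eventually_mono\<close>)
  have intf: "integrable P (\<lambda>x. f (mat_app n (H \<theta>) x))" for \<theta>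
  proof -
    have "norm (f x) \<le> C" for x
    proof -
      have k1: "(x k)^2 + (x l)^2 \<le> sumsq D x"
        unfolding sumsq_def using finite_D kl l by (simp add: sum.remove[of D k] sum.remove[of "D - {k}" l] sum_nonneg)
      have "\<bar>x k * x l\<bar> \<le> sumsq D x"
      proof -
        have "2 * (\<bar>x k\<bar> * \<bar>x l\<bar>) \<le> sumsq D x"
          using k1 sum_squares_bound[of "\<bar>x k\<bar>" "\<bar>x l\<bar>"] by simp
        moreover have "0 \<le> \<bar>x k\<bar> * \<bar>x l\<bar>" by simp
        ultimately show ?thesis unfolding abs_mult by linarith
      qed
      \<comment> \<open>Where \<open>sumsq D x = 0\<close> the quotient is 0, so the bound holds
        everywhere.\<close>
      then have "\<bar>x k * x l / sumsq D x\<bar> \<le> 1"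
        unfolding abs_divide by (metis abs_ge_zero abs_of_nonneg divide_le_eq_1 order_le_less sumsq_nonneg zero_le_one div_by_0)
      then have "\<bar>x k * x l / sumsq D x\<bar> * norm (h (sumsq A x / sumsq D x)) \<le> 1 * C"
        using sumsq_ratio_bounds[OF finite_D A, unfolded sumsq_ratio_def] by (intro mult_mono bd) auto
      then show ?thesis by (simp only: f_def norm_mult norm_of_real mult_1_left)
    qed
    then show ?thesis by (intro integrable_const_bound[of _ C]) auto
  qed
  \<comment> \<open>Difference quotients at \<theta> = 1/(N + 1). They start from
    \<open>H 0\<close>, a sign change and not the identity; by invariance both terms have the same
    integral.\<close>
  define s where "s = (\<lambda>N x. of_nat (Suc N) * (f (mat_app n (H (1 / real (Suc N))) x) - f (mat_app n (H 0) x)))"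
  have "(\<lambda>N. \<integral>x. s N x \<partial>P) \<longlonglongrightarrow> (\<integral>x. g x \<partial>P)"
  proof (rule integral_dominated_convergence[where w = "\<lambda>_. B"])
    show "AE x in P. (\<lambda>N. s N x) \<longlonglongrightarrow> g x"
      using pos
    proof eventually_elim
      case (elim x)
      have "((\<lambda>\<theta>. norm (f (mat_app n (H \<theta>) x) - f (mat_app n (H 0) x) - \<theta> *\<^sub>R g x) / norm \<theta>) \<longlongrightarrow> 0) (at 0)"
        using main[OF elim] by (simp add: has_vector_derivative_def has_derivative_at)
      moreover have "filterlim (\<lambda>N. 1 / real (Suc N)) (at 0) sequentially"
        unfolding filterlim_at using LIMSEQ_inverse_real_of_nat by (simp add: inverse_eq_divide)
      ultimately have "(\<lambda>N. norm (f (mat_app n (H (1 / real (Suc N))) x) - f (mat_app n (H 0) x) - (1 / real (Suc N)) *\<^sub>R g x) / norm (1 / real (Suc N))) \<longlonglongrightarrow> 0"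
        by (rule filterlim_compose)
      moreover have "norm (f (mat_app n (H (1 / real (Suc N))) x) - f (mat_app n (H 0) x) - (1 / real (Suc N)) *\<^sub>R g x) / norm (1 / real (Suc N)) = norm (s N x - g x)" for N
      proof -
        have "s N x - g x = of_nat (Suc N) * (f (mat_app n (H (1 / real (Suc N))) x) - f (mat_app n (H 0) x) - (1 / real (Suc N)) *\<^sub>R g x)"
          unfolding s_def right_diff_distrib by (simp add: scaleR_conv_of_real del: of_nat_Suc)
        then have "norm (s N x - g x) = real (Suc N) * norm (f (mat_app n (H (1 / real (Suc N))) x) - f (mat_app n (H 0) x) - (1 / real (Suc N)) *\<^sub>R g x)"
          by (simp only: norm_mult norm_of_nat)
        then show ?thesis by simp
      qed
      ultimately have "(\<lambda>N. norm (s N x - g x)) \<longlonglongrightarrow> 0" by (simp only:)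
      then show ?case by (simp only: tendsto_norm_zero_iff LIM_zero_iff)
    qed
    show "AE x in P. norm (s N x) \<le> B" for N
      using pos
    proof eventually_elim
      case (elim x)
      have "norm (s N x) = real (Suc N) * norm (f (mat_app n (H (1 / real (Suc N))) x) - f (mat_app n (H 0) x))"
        unfolding s_def norm_mult norm_of_nat ..
      also have "\<dots> \<le> real (Suc N) * (B * norm (1 / real (Suc N)))"
        by (rule mult_left_mono[OF main[OF elim, THEN conjunct2, THEN conjunct1, rule_format]]) simp
      finally show ?case by simp
    qed
  next
    show "s N \<in> borel_measurable P" for N unfolding s_def by measurable
  qed simp_all
  moreover have "(\<integral>x. s N x \<partial>P) = 0" for N
  proof -
    have "(\<integral>x. s N x \<partial>P) = of_nat (Suc N) * ((\<integral>x. f (mat_app n (H (1 / real (Suc N))) x) \<partial>P) - (\<integral>x. f (mat_app n (H 0) x) \<partial>P))"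
      unfolding s_def by (subst integral_mult_right_zero, subst Bochner_Integration.integral_diff[OF intf intf]) (rule refl)
    then show ?thesis by (simp add: integral_mat_app[OF H(1)] del: of_nat_Suc)
  qed
  ultimately show "(\<integral>x. g x \<partial>P) = 0" by (simp add: LIMSEQ_const_iff)
qed

end

text \<open>
  The value \<open>0\<close> at the origin makes \<open>u\<^sup>i\<^sup>\<tau>\<close> multiplicative on all of \<open>[0, \<infinity>)\<close>, so that degenerate
  configurations need no separate treatment; for \<open>\<tau> = 0\<close> it is the indicator of \<open>u \<noteq> 0\<close>.
\<close>

definition unit_power :: "real \<Rightarrow> real \<Rightarrow> complex" where
  "unit_power \<tau> u = (if u = 0 then 0 else exp (\<i> * of_real (\<tau> * ln u)))"

lemma unit_power_mult:
  assumes "0 \<le> u" "0 \<le> v"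
  shows "unit_power \<tau> (u * v) = unit_power \<tau> u * unit_power \<tau> v"
  using assms by (auto simp: unit_power_def ln_mult exp_add[symmetric] algebra_simps)

lemma norm_unit_power: "norm (unit_power \<tau> u) \<le> 1"
  by (simp add: unit_power_def norm_exp_i_times del: of_real_mult)

lemma unit_power_measurable [measurable]: "unit_power \<tau> \<in> borel_measurable borel"
  unfolding unit_power_def by measurable

text \<open>Combines |exp (i v) - 1| \<le> |v| with ln (1/u) \<le> 1/u - 1; the factor
  \<open>u\<close> clears the denominator. This is the pointwise source of the hypothesis
  \<open>close\<close> in \<open>beta_recurrence_estimate\<close>.\<close>

lemma norm_unit_power_minus_one_le:
  assumes "0 < u" "u \<le> 1"
  shows "u * norm (unit_power \<tau> u - 1) \<le> \<bar>\<tau>\<bar> * (1 - u)"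
proof -
  have "norm (unit_power \<tau> u - 1) \<le> \<bar>\<tau> * ln u\<bar>"
    using iexp_approx1[of "\<tau> * ln u" 0] assms by (simp add: unit_power_def)
  also have "\<dots> = \<bar>\<tau>\<bar> * ln (1/u)" using assms by (simp add: abs_mult ln_div)
  also have "\<dots> \<le> \<bar>\<tau>\<bar> * (1/u - 1)"
    using assms by (intro mult_left_mono ln_le_minus_one) auto
  finally have "u * norm (unit_power \<tau> u - 1) \<le> u * (\<bar>\<tau>\<bar> * (1/u - 1))"
    using assms by (intro mult_left_mono) auto
  also have "\<dots> = \<bar>\<tau>\<bar> * (1 - u)" using assms by (simp add: field_simps)
  finally show ?thesis .
qed

section \<open>Moments of the share of squared length\<close>

context spherical_law
begin

context
  fixes A D :: "nat set"
  assumes D: "D \<subseteq> {..<n}" and A: "A \<subseteq> D"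
    and pos: "AE x in P. 0 < sumsq D x"
begin

abbreviation ratio :: "(nat \<Rightarrow> real) \<Rightarrow> real" where
  "ratio \<equiv> sumsq_ratio A D"

lemma finite_D: "finite D" using D finite_subset by auto

lemma ratio_measurable [measurable]: "ratio \<in> borel_measurable (vec_space n)"
  using A D by (intro sumsq_ratio_measurable) auto

lemma ratio_bounds: "0 \<le> ratio x" "ratio x \<le> 1"
  by (rule sumsq_ratio_bounds[OF finite_D A])+

text \<open>Summing \<open>stein_pair\<close> over all k in \<open>A\<close> and l in
  \<open>D - A\<close>, the weights add up to d U - a and U (1 - U), with d and a the cardinalities
  of \<open>D\<close> and \<open>A\<close>.\<close>

lemma stein_equation:
  fixes h h' :: "real \<Rightarrow> complex"
  assumes h: "\<And>u. 0 \<le> u \<Longrightarrow> u \<le> 1 \<Longrightarrow> (h has_vector_derivative h' u) (at u)"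
    and bd: "\<And>u. 0 \<le> u \<Longrightarrow> u \<le> 1 \<Longrightarrow> norm (h u) \<le> C" "\<And>u. 0 \<le> u \<Longrightarrow> u \<le> 1 \<Longrightarrow> norm (h' u) \<le> C"
    and [measurable]: "h \<in> borel_measurable borel" "h' \<in> borel_measurable borel"
  shows "(\<integral>x. of_real (card D * ratio x - card A) * h (ratio x)
            - 2 * of_real (ratio x * (1 - ratio x)) * h' (ratio x) \<partial>P) = 0"
proof -
  have finA: "finite A" using finite_D A finite_subset by auto
  define g where "g = (\<lambda>k l x. of_real (((x k)^2 - (x l)^2) / sumsq D x) * h (ratio x)
                    - 2 * of_real ((x k)^2 * (x l)^2 / (sumsq D x)^2) * h' (ratio x))"
  have g: "integrable P (g k l)" "(\<integral>x. g k l x \<partial>P) = 0" if "k \<in> A" "l \<in> D - A" for k l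
    using stein_pair[OF D A pos h bd assms(4,5) that] by (simp_all add: g_def sumsq_ratio_def)
  have pw: "of_real (card D * ratio x - card A) * h (ratio x) - 2 * of_real (ratio x * (1 - ratio x)) * h' (ratio x)
      = (\<Sum>k\<in>A. \<Sum>l\<in>D-A. g k l x)" if S: "0 < sumsq D x" for x
  proof -
    have sub: "sumsq (D - A) x = sumsq D x - sumsq A x"
      unfolding sumsq_def by (rule sum_diff[OF finite_D A])
    have card: "real (card (D - A)) = real (card D) - real (card A)"
      using finA A finite_D by (simp add: card_Diff_subset card_mono of_nat_diff)
    have "(\<Sum>k\<in>A. \<Sum>l\<in>D-A. (x k)^2 - (x l)^2) = real (card (D - A)) * sumsq A x - real (card A) * sumsq (D - A) x"
      by (simp add: sum_subtractf sumsq_def sum_distrib_left)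
    also have "\<dots> = card D * sumsq A x - card A * sumsq D x" unfolding sub card by (simp add: algebra_simps)
    finally have "(\<Sum>k\<in>A. \<Sum>l\<in>D-A. ((x k)^2 - (x l)^2) / sumsq D x) = (card D * sumsq A x - card A * sumsq D x) / sumsq D x"
      by (simp only: sum_divide_distrib[symmetric])
    then have 1: "(\<Sum>k\<in>A. \<Sum>l\<in>D-A. ((x k)^2 - (x l)^2) / sumsq D x) = card D * ratio x - card A"
      using S by (simp add: sumsq_ratio_def diff_divide_distrib)
    have "(\<Sum>k\<in>A. \<Sum>l\<in>D-A. (x k)^2 * (x l)^2) = sumsq A x * sumsq (D - A) x"
      by (simp add: sumsq_def sum_product)
    then have "(\<Sum>k\<in>A. \<Sum>l\<in>D-A. (x k)^2 * (x l)^2 / (sumsq D x)^2) = sumsq A x * (sumsq D x - sumsq A x) / (sumsq D x)^2"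
      by (simp only: sum_divide_distrib[symmetric] sub)
    also have "\<dots> = ratio x * ((sumsq D x - sumsq A x) / sumsq D x)" by (simp add: sumsq_ratio_def power2_eq_square)
    also have "(sumsq D x - sumsq A x) / sumsq D x = 1 - ratio x" using S by (simp add: sumsq_ratio_def diff_divide_distrib)
    finally have 2: "(\<Sum>k\<in>A. \<Sum>l\<in>D-A. (x k)^2 * (x l)^2 / (sumsq D x)^2) = ratio x * (1 - ratio x)" .
    have "(\<Sum>k\<in>A. \<Sum>l\<in>D-A. g k l x) = of_real (\<Sum>k\<in>A. \<Sum>l\<in>D-A. ((x k)^2 - (x l)^2) / sumsq D x) * h (ratio x)
          - 2 * of_real (\<Sum>k\<in>A. \<Sum>l\<in>D-A. (x k)^2 * (x l)^2 / (sumsq D x)^2) * h' (ratio x)"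
      unfolding g_def sum_subtractf sum_distrib_right[symmetric] sum_distrib_left[symmetric] of_real_sum ..
    then show ?thesis unfolding 1 2 by simp
  qed
  have "(\<integral>x. of_real (card D * ratio x - card A) * h (ratio x)
            - 2 * of_real (ratio x * (1 - ratio x)) * h' (ratio x) \<partial>P) = (\<integral>x. (\<Sum>k\<in>A. \<Sum>l\<in>D-A. g k l x) \<partial>P)"
  proof (rule integral_cong_AE)
    show "AE x in P. of_real (card D * ratio x - card A) * h (ratio x)
            - 2 * of_real (ratio x * (1 - ratio x)) * h' (ratio x) = (\<Sum>k\<in>A. \<Sum>l\<in>D-A. g k l x)"
      using pos by eventually_elim (rule pw)
    show "(\<lambda>x. \<Sum>k\<in>A. \<Sum>l\<in>D-A. g k l x) \<in> borel_measurable P"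
      using g by (intro borel_measurable_sum borel_measurable_integrable) auto
  qed measurable
  also have "\<dots> = (\<Sum>k\<in>A. \<Sum>l\<in>D-A. (\<integral>x. g k l x \<partial>P))"
  proof -
    have "(\<integral>x. (\<Sum>k\<in>A. \<Sum>l\<in>D-A. g k l x) \<partial>P) = (\<Sum>k\<in>A. (\<integral>x. (\<Sum>l\<in>D-A. g k l x) \<partial>P))"
      by (rule Bochner_Integration.integral_sum) (rule Bochner_Integration.integrable_sum, rule g)
    also have "\<dots> = (\<Sum>k\<in>A. \<Sum>l\<in>D-A. (\<integral>x. g k l x \<partial>P))"
      by (intro sum.cong refl Bochner_Integration.integral_sum g)
    finally show ?thesis .
  qed
  also have "\<dots> = 0" by (intro sum.neutral ballI g)
  finally show ?thesis .
qed

lemma ratio_pos_AE: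
  assumes "A \<noteq> {}"
  shows "AE x in P. 0 < ratio x"
proof -
  \<comment> \<open>The test functions \<open>\<epsilon> / (\<epsilon> + u)\<close> tend to the indicator of \<open>u = 0\<close>; the Stein equation becomes \<open>- a P(U = 0) = 0\<close>.\<close>
  define \<epsilon> where "\<epsilon> = (\<lambda>N. inverse (real (Suc N)))"
  have \<epsilon>: "0 < \<epsilon> N" for N by (simp add: \<epsilon>_def)
  have \<epsilon>_lim: "\<epsilon> \<longlonglongrightarrow> 0" unfolding \<epsilon>_def by (rule LIMSEQ_inverse_real_of_nat)
  define r where "r = (\<lambda>N x. (card D * ratio x - card A) * (\<epsilon> N / (\<epsilon> N + ratio x)) + 2 * (ratio x * (1 - ratio x)) * (\<epsilon> N / (\<epsilon> N + ratio x)^2))"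
  have [measurable]: "r N \<in> borel_measurable (vec_space n)" for N unfolding r_def by measurable
  have r0: "(\<integral>x. r N x \<partial>P) = 0" for N
  proof -
    have "(\<integral>x. of_real (card D * ratio x - card A) * complex_of_real (\<epsilon> N / (\<epsilon> N + ratio x))
            - 2 * of_real (ratio x * (1 - ratio x)) * of_real (- \<epsilon> N / (\<epsilon> N + ratio x)^2) \<partial>P) = 0"
    proof (rule stein_equation[where C = "1 + 1 / \<epsilon> N"])
      fix u :: real assume u: "0 \<le> u" "u \<le> 1"
      have p: "\<epsilon> N + u > 0" using u \<epsilon>[of N] by linarith
      show "((\<lambda>u. complex_of_real (\<epsilon> N / (\<epsilon> N + u))) has_vector_derivative complex_of_real (- \<epsilon> N / (\<epsilon> N + u)^2)) (at u)"
        using p by (intro has_vector_derivative_of_real) (auto intro!: derivative_eq_intros simp: power2_eq_square)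
      have "\<bar>\<epsilon> N / (\<epsilon> N + u)\<bar> \<le> 1" using p u \<epsilon>[of N] by simp
      also have "1 \<le> 1 + 1 / \<epsilon> N" using \<epsilon>[of N] by simp
      finally show "norm (complex_of_real (\<epsilon> N / (\<epsilon> N + u))) \<le> 1 + 1 / \<epsilon> N" by (simp only: norm_of_real)
      have "\<bar>- \<epsilon> N / (\<epsilon> N + u)^2\<bar> \<le> \<epsilon> N / (\<epsilon> N)^2"
        using u \<epsilon>[of N] p by (simp only: abs_divide abs_minus abs_of_pos abs_power2) (intro divide_left_mono power_mono mult_pos_pos zero_less_power, auto)
      also have "\<dots> \<le> 1 + 1 / \<epsilon> N" using \<epsilon>[of N] by (simp add: power2_eq_square)
      finally show "norm (complex_of_real (- \<epsilon> N / (\<epsilon> N + u)^2)) \<le> 1 + 1 / \<epsilon> N" by (simp only: norm_of_real)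
    qed measurable
    also have "(\<lambda>x. of_real (card D * ratio x - card A) * complex_of_real (\<epsilon> N / (\<epsilon> N + ratio x))
            - 2 * of_real (ratio x * (1 - ratio x)) * of_real (- \<epsilon> N / (\<epsilon> N + ratio x)^2)) = (\<lambda>x. complex_of_real (r N x))"
      by (rule ext) (simp add: r_def)
    finally show ?thesis by (simp only: integral_complex_of_real of_real_eq_0_iff)
  qed
  have "(\<lambda>N. \<integral>x. r N x \<partial>P) \<longlonglongrightarrow> (\<integral>x. (if ratio x = 0 then - real (card A) else 0) \<partial>P)"
  proof (rule integral_dominated_convergence[where w = "\<lambda>_. real (card D + card A) + 2"])
    show "AE x in P. (\<lambda>N. r N x) \<longlonglongrightarrow> (if ratio x = 0 then - real (card A) else 0)"
    proof (rule AE_I2)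
      fix x
      show "(\<lambda>N. r N x) \<longlonglongrightarrow> (if ratio x = 0 then - real (card A) else 0)"
      proof (cases "ratio x = 0")
        case True
        then have "r N x = - real (card A)" for N using \<epsilon>[of N] by (simp add: r_def)
        then show ?thesis using True by simp
      next
        case False
        have "(\<lambda>N. r N x) \<longlonglongrightarrow> (card D * ratio x - card A) * (0 / (0 + ratio x)) + 2 * (ratio x * (1 - ratio x)) * (0 / (0 + ratio x)^2)"
          unfolding r_def using False by (intro tendsto_intros \<epsilon>_lim) auto
        then show ?thesis using False by simp
      qed
    qed
    show "AE x in P. norm (r N x) \<le> real (card D + card A) + 2" for N
    proof (rule AE_I2)
      fix x
      define u where "u = ratio x"
      have u: "0 \<le> u" "u \<le> 1" using ratio_bounds by (auto simp: u_def)
      have p: "\<epsilon> N + u > 0" using u \<epsilon>[of N] by linarith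
      have 1: "\<bar>\<epsilon> N / (\<epsilon> N + u)\<bar> \<le> 1" using p u \<epsilon>[of N] by simp
      have 2: "\<bar>u / (\<epsilon> N + u)\<bar> \<le> 1" using p u \<epsilon>[of N] by simp
      have 3: "\<bar>card D * u - card A\<bar> \<le> real (card D + card A)"
      proof -
        have "0 \<le> card D * u" "card D * u \<le> card D" using u by (simp_all add: mult_left_le)
        then show ?thesis unfolding abs_le_iff of_nat_add by linarith
      qed
      \<comment> \<open>Giving one factor \<epsilon> + u to u and the other to \<epsilon> bounds the
        derivative term independently of \<open>N\<close>, although the derivative itself has size
        1/\<epsilon> at 0.\<close>
      have "r N x = (card D * u - card A) * (\<epsilon> N / (\<epsilon> N + u)) + 2 * (1 - u) * ((u / (\<epsilon> N + u)) * (\<epsilon> N / (\<epsilon> N + u)))"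
        by (simp add: r_def u_def power2_eq_square)
      then have "\<bar>r N x\<bar> \<le> \<bar>card D * u - card A\<bar> * \<bar>\<epsilon> N / (\<epsilon> N + u)\<bar> + \<bar>2 * (1 - u)\<bar> * (\<bar>u / (\<epsilon> N + u)\<bar> * \<bar>\<epsilon> N / (\<epsilon> N + u)\<bar>)"
        by (simp only: abs_mult[symmetric] abs_triangle_ineq)
      also have "\<dots> \<le> real (card D + card A) * 1 + 2 * (1 * 1)"
        using u by (intro add_mono mult_mono 1 2 3) auto
      finally show "norm (r N x) \<le> real (card D + card A) + 2" by simp
    qed
  qed auto
  then have "(\<integral>x. (if ratio x = 0 then - real (card A) else 0) \<partial>P) = 0"
    unfolding r0 by (simp add: LIMSEQ_const_iff)
  moreover have "(\<integral>x. (if ratio x = 0 then - real (card A) else 0) \<partial>P) = - (\<integral>x. (if ratio x = 0 then real (card A) else 0) \<partial>P)"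
    unfolding Bochner_Integration.integral_minus[symmetric] by (intro Bochner_Integration.integral_cong) auto
  ultimately have "(\<integral>x. (if ratio x = 0 then real (card A) else 0) \<partial>P) = 0" by simp
  moreover have "integrable P (\<lambda>x. if ratio x = 0 then real (card A) else 0)"
    by (rule integrable_const_bound[of _ "real (card A)"]) auto
  ultimately have "AE x in P. (if ratio x = 0 then real (card A) else 0) = 0"
    by (subst (asm) integral_nonneg_eq_0_iff_AE) auto
  then show ?thesis
  proof eventually_elim
    case (elim x)
    have "card A > 0" using assms finite_subset[OF A finite_D] by (simp add: card_gt_0_iff)
    then have "ratio x \<noteq> 0" using elim by (cases "ratio x = 0") simp_all
    then show ?case using ratio_bounds(1)[of x] by linarith
  qed
qed

text \<open>This is E U^(N + i \<tau>), split so that the factor of modulus 1 takes its default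
  value 0 where U = 0.\<close>

definition moment :: "real \<Rightarrow> nat \<Rightarrow> complex" where
  "moment \<tau> N = (\<integral>x. of_real (ratio x ^ N) * unit_power \<tau> (ratio x) \<partial>P)"

lemma moment_integrable: "integrable P (\<lambda>x. of_real (ratio x ^ N) * unit_power \<tau> (ratio x))"
proof (rule integrable_const_bound[of _ 1])
  show "AE x in P. norm (of_real (ratio x ^ N) * unit_power \<tau> (ratio x)) \<le> 1"
  proof (rule AE_I2)
    fix x
    have "\<bar>ratio x ^ N\<bar> * norm (unit_power \<tau> (ratio x)) \<le> 1 * 1"
      using ratio_bounds[of x] by (intro mult_mono norm_unit_power) (auto intro: power_le_one)
    then show "norm (of_real (ratio x ^ N) * unit_power \<tau> (ratio x)) \<le> 1"
      by (simp only: norm_mult norm_of_real mult_1_left)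
  qed
qed measurable

lemma moment_recurrence:
  assumes "A \<noteq> {}"
  shows "(of_real (card D / 2 + N) + \<i> * of_real \<tau>) * moment \<tau> (Suc N)
       = (of_real (card A / 2 + N) + \<i> * of_real \<tau>) * moment \<tau> N"
proof -
  \<comment> \<open>The Stein equation is applied to \<open>(u + \<epsilon>)\<^sup>s\<close>, since \<open>u\<^sup>s\<close> need not be differentiable at \<open>0\<close>.\<close>
  define s where "s = of_real (real N) + \<i> * of_real \<tau>"
  define \<epsilon> where "\<epsilon> = (\<lambda>N. inverse (real (Suc N)))"
  have \<epsilon>: "0 < \<epsilon> K" "\<epsilon> K \<le> 1" for K by (simp_all add: \<epsilon>_def divide_simps)
  have \<epsilon>_lim: "\<epsilon> \<longlonglongrightarrow> 0" unfolding \<epsilon>_def by (rule LIMSEQ_inverse_real_of_nat)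
  \<comment> \<open>This is 2^N, which bounds |(u + \<epsilon>)^s| because u + \<epsilon> \<le> 2
    and \<open>s\<close> has real part \<open>N\<close>.\<close>
  define C where "C = exp (real N * ln 2)"
  define h where "h = (\<lambda>K u. exp (s * of_real (ln (u + \<epsilon> K))))"
  define h' where "h' = (\<lambda>K u. of_real (1 / (u + \<epsilon> K)) * s * h K u)"
  define g where "g = (\<lambda>K x. of_real (card D * ratio x - card A) * h K (ratio x)
            - 2 * of_real (ratio x * (1 - ratio x)) * h' K (ratio x))"
  define G where "G = (\<lambda>x. of_real (ratio x ^ N) * unit_power \<tau> (ratio x))"
  have C0: "C > 0" by (simp add: C_def)
  have hm[measurable]: "h K \<in> borel_measurable borel" "h' K \<in> borel_measurable borel" for K
    unfolding h'_def h_def by measurable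
  have nh: "norm (h K u) \<le> C" if "0 \<le> u" "u \<le> 1" for K u
  proof -
    have "norm (h K u) = exp (real N * ln (u + \<epsilon> K))" by (simp add: h_def s_def)
    also have "ln (u + \<epsilon> K) \<le> ln 2" using that \<epsilon>[of K] by (subst ln_le_cancel_iff) auto
    finally show ?thesis by (simp add: C_def mult_left_mono)
  qed
  have g0: "(\<integral>x. g K x \<partial>P) = 0" for K
    unfolding g_def
  proof (rule stein_equation[where C = "C + (1 / \<epsilon> K) * norm s * C"])
    fix u :: real assume u: "0 \<le> u" "u \<le> 1"
    have p: "u + \<epsilon> K > 0" using u \<epsilon>[of K] by linarith
    have 1: "((\<lambda>u. s * of_real (ln (u + \<epsilon> K))) has_vector_derivative s * of_real (1 / (u + \<epsilon> K))) (at u)"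
      using p by (intro has_vector_derivative_mult_right has_vector_derivative_of_real)
                 (auto intro!: derivative_eq_intros)
    show "(h K has_vector_derivative h' K u) (at u)"
      using field_vector_diff_chain_at[OF 1 DERIV_exp]
      unfolding o_def h_def h'_def by (simp only: mult_ac)
    have nn: "0 \<le> (1 / \<epsilon> K) * norm s * C" using \<epsilon>[of K] C0 by (intro mult_nonneg_nonneg) auto
    then show "norm (h K u) \<le> C + (1 / \<epsilon> K) * norm s * C" using nh[OF u, of K] by linarith
    have "norm (h' K u) = \<bar>1 / (u + \<epsilon> K)\<bar> * norm s * norm (h K u)"
      by (simp only: h'_def norm_mult norm_of_real)
    also have "\<dots> \<le> (1 / \<epsilon> K) * norm s * C"
      using u \<epsilon>[of K] p C0 by (intro mult_mono nh u) (auto simp: frac_le)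
    finally show "norm (h' K u) \<le> C + (1 / \<epsilon> K) * norm s * C" using C0 by linarith
  qed measurable
  \<comment> \<open>As the derivative is s h / (u + \<epsilon>), the factor U in U (1 - U) absorbs
    its singularity, both in the limit s (1 - U) U^s and in the dominating constant.\<close>
  have "(\<lambda>K. \<integral>x. g K x \<partial>P) \<longlonglongrightarrow> (\<integral>x. of_real (card D * ratio x - card A) * G x - 2 * of_real (1 - ratio x) * s * G x \<partial>P)"
  proof (rule integral_dominated_convergence[where w = "\<lambda>_. real (card D + card A) * C + 2 * norm s * C"])
    show "AE x in P. (\<lambda>K. g K x) \<longlonglongrightarrow> of_real (card D * ratio x - card A) * G x - 2 * of_real (1 - ratio x) * s * G x"
      using ratio_pos_AE[OF assms]
    proof eventually_elim
      case (elim x)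
      have hlim: "(\<lambda>K. h K (ratio x)) \<longlonglongrightarrow> G x"
      proof -
        have "(\<lambda>K. h K (ratio x)) \<longlonglongrightarrow> exp (s * of_real (ln (ratio x + 0)))"
          unfolding h_def using elim by (intro tendsto_intros \<epsilon>_lim) auto
        also have "exp (s * of_real (ln (ratio x + 0))) = G x"
        proof -
          have "ratio x ^ N = exp (real N * ln (ratio x))" using elim by (simp add: exp_of_nat_mult)
          then have "of_real (ratio x ^ N) = exp (of_real (real N * ln (ratio x)) :: complex)"
            by (simp only: exp_of_real)
          then show ?thesis using elim
            by (simp add: G_def s_def unit_power_def distrib_right exp_add mult.assoc)
        qed
        finally show ?thesis .
      qed
      have "(\<lambda>K. g K x) \<longlonglongrightarrow> of_real (card D * ratio x - card A) * G x - 2 * (of_real (ratio x * (1 - ratio x)) * (of_real (1 / (ratio x + 0)) * s * G x))"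
        unfolding g_def mult.assoc[of 2] h'_def using elim by (intro tendsto_intros \<epsilon>_lim hlim) auto
      also have "of_real (ratio x * (1 - ratio x)) * (of_real (1 / (ratio x + 0)) * s * G x) = of_real (1 - ratio x) * s * G x"
        using elim by simp
      finally show ?case by (simp only: mult.assoc)
    qed
    show "AE x in P. norm (g K x) \<le> real (card D + card A) * C + 2 * norm s * C" for K
    proof (rule AE_I2)
      fix x
      define u where "u = ratio x"
      have u: "0 \<le> u" "u \<le> 1" using ratio_bounds by (auto simp: u_def)
      have p: "u + \<epsilon> K > 0" using u \<epsilon>[of K] by linarith
      have 3: "\<bar>card D * u - card A\<bar> \<le> real (card D + card A)"
      proof -
        have "0 \<le> card D * u" "card D * u \<le> card D" using u by (simp_all add: mult_left_le)
        then show ?thesis unfolding abs_le_iff of_nat_add by linarith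
      qed
      have "u / (u + \<epsilon> K) \<le> 1" using p u \<epsilon>[of K] by simp
      then have 2: "\<bar>u * (1 - u) * (1 / (u + \<epsilon> K))\<bar> \<le> 1"
        using mult_mono[of "u / (u + \<epsilon> K)" 1 "1 - u" 1] p u by (simp add: abs_mult mult_ac)
      have "g K x = of_real (card D * u - card A) * h K u - 2 * (of_real (u * (1 - u) * (1 / (u + \<epsilon> K))) * s * h K u)"
        by (simp add: g_def h'_def u_def mult.assoc)
      also have "norm \<dots> \<le> \<bar>card D * u - card A\<bar> * norm (h K u) + 2 * (\<bar>u * (1 - u) * (1 / (u + \<epsilon> K))\<bar> * norm s * norm (h K u))"
        by (rule order_trans[OF norm_triangle_ineq4]) (simp only: norm_mult norm_of_real norm_numeral order_refl)
      also have "\<dots> \<le> real (card D + card A) * C + 2 * (1 * norm s * C)"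
        using u C0 by (intro add_mono mult_mono 2 3 nh order_refl mult_nonneg_nonneg) auto
      finally show "norm (g K x) \<le> real (card D + card A) * C + 2 * norm s * C" by simp
    qed
    show "(\<lambda>x. of_real (card D * ratio x - card A) * G x - 2 * of_real (1 - ratio x) * s * G x) \<in> borel_measurable P"
      unfolding G_def by measurable
    show "g K \<in> borel_measurable P" for K unfolding g_def by measurable
  qed simp
  then have "0 = (\<integral>x. of_real (card D * ratio x - card A) * G x - 2 * of_real (1 - ratio x) * s * G x \<partial>P)"
    unfolding g0 by (simp add: LIMSEQ_const_iff)
  \<comment> \<open>Collects (d U - a) - 2 s (1 - U) = (d + 2 s) U - (a + 2 s).\<close>
  also have "(\<lambda>x. of_real (card D * ratio x - card A) * G x - 2 * of_real (1 - ratio x) * s * G x)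
     = (\<lambda>x. (of_real (card D) + 2 * s) * (of_real (ratio x ^ Suc N) * unit_power \<tau> (ratio x)) - (of_real (card A) + 2 * s) * G x)"
    by (rule ext) (simp add: G_def algebra_simps)
  also have "(\<integral>x. \<dots> x \<partial>P) = (of_real (card D) + 2 * s) * moment \<tau> (Suc N) - (of_real (card A) + 2 * s) * moment \<tau> N"
    unfolding G_def moment_def
    by (subst Bochner_Integration.integral_diff) (simp_all only: integrable_mult_right moment_integrable integral_mult_right_zero)
  finally have "(of_real (card D) + 2 * s) * moment \<tau> (Suc N) = (of_real (card A) + 2 * s) * moment \<tau> N" by simp
  then have "2 * ((of_real (card D / 2 + N) + \<i> * of_real \<tau>) * moment \<tau> (Suc N))
       = 2 * ((of_real (card A / 2 + N) + \<i> * of_real \<tau>) * moment \<tau> N)"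
    by (simp add: s_def algebra_simps)
  then show ?thesis by (simp only: mult_cancel_left) simp
qed

text \<open>\<open>beta_recurrence_estimate\<close> applies with the cardinalities as parameters;
  the recurrence of the real moments is the complex one at \<tau> = 0.\<close>

lemma char_log_ratio_estimate:
  fixes \<tau> :: real
  assumes cA: "4 \<le> card A" and \<tau>: "4 * \<bar>\<tau>\<bar> \<le> card A"
  shows "norm ((\<integral>x. unit_power \<tau> (ratio x) \<partial>P) * exp (log_prim \<tau> (card D / 2) - log_prim \<tau> (card A / 2)) - 1)
       \<le> exp (80 * (\<bar>\<tau>\<bar> + \<tau>^2 + \<bar>\<tau>\<bar>^3) / (real (card A))^2) - 1"
proof -
  have ne: "A \<noteq> {}" using cA by auto
  define \<mu> where "\<mu> = (\<lambda>N. \<integral>x. ratio x ^ N \<partial>P)"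
  have int: "integrable P (\<lambda>x. ratio x ^ N)" for N
    by (rule integrable_const_bound[of _ 1]) (auto intro!: AE_I2 power_le_one ratio_bounds simp: power_abs abs_of_nonneg[OF ratio_bounds(1)])
  \<comment> \<open>\<open>unit_power 0\<close> is 1 only away from 0, so the absence of mass at U =
    0 enters here.\<close>
  have m0: "moment 0 N = of_real (\<mu> N)" for N
  proof -
    have "moment 0 N = (\<integral>x. of_real (ratio x ^ N) \<partial>P)"
      unfolding moment_def
    proof (rule integral_cong_AE)
      show "AE x in P. of_real (ratio x ^ N) * unit_power 0 (ratio x) = of_real (ratio x ^ N)"
        using ratio_pos_AE[OF ne] by eventually_elim (simp add: unit_power_def)
    qed measurable
    then show ?thesis by (simp only: \<mu>_def integral_complex_of_real)
  qed
  have "norm (moment \<tau> 0 * exp (log_prim \<tau> (card D / 2) - log_prim \<tau> (card A / 2)) - 1)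
       \<le> exp (80 * (\<bar>\<tau>\<bar> + \<tau>^2 + \<bar>\<tau>\<bar>^3) / (real (card A))^2) - 1"
  proof (rule beta_recurrence_estimate[where \<mu> = \<mu>])
    show "4 \<le> real (card A)" "4 * \<bar>\<tau>\<bar> \<le> card A" using cA \<tau> by auto
    show "real (card A) \<le> card D" using card_mono[OF finite_D A] by simp
    show "(of_real (card D / 2 + N) + \<i> * of_real \<tau>) * moment \<tau> (Suc N)
       = (of_real (card A / 2 + N) + \<i> * of_real \<tau>) * moment \<tau> N" for N by (rule moment_recurrence[OF ne])
    have "complex_of_real ((card D / 2 + N) * \<mu> (Suc N)) = of_real ((card A / 2 + N) * \<mu> N)" for N
      using moment_recurrence[OF ne, of N 0] unfolding m0 by (simp only: of_real_0 mult_zero_right add_0_right of_real_mult)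
    then show "(card D / 2 + N) * \<mu> (Suc N) = (card A / 2 + N) * \<mu> N" for N by (simp only: of_real_eq_iff)
    show "\<mu> 0 = 1" by (simp add: \<mu>_def prob_space)
    show "norm (moment \<tau> (Suc N) - of_real (\<mu> (Suc N))) \<le> \<bar>\<tau>\<bar> * (\<mu> N - \<mu> (Suc N))" for N
    proof -
      have "moment \<tau> (Suc N) - of_real (\<mu> (Suc N)) = (\<integral>x. of_real (ratio x ^ Suc N) * unit_power \<tau> (ratio x) - of_real (ratio x ^ Suc N) \<partial>P)"
        unfolding moment_def \<mu>_def integral_complex_of_real[symmetric]
        by (rule Bochner_Integration.integral_diff[symmetric]) (intro moment_integrable integrable_of_real int)+
      also have "norm \<dots> \<le> (\<integral>x. \<bar>\<tau>\<bar> * (ratio x ^ N - ratio x ^ Suc N) \<partial>P)"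
      proof (rule order_trans[OF integral_norm_bound], rule integral_mono)
        show "integrable P (\<lambda>x. norm (of_real (ratio x ^ Suc N) * unit_power \<tau> (ratio x) - of_real (ratio x ^ Suc N)))"
          by (intro integrable_norm Bochner_Integration.integrable_diff moment_integrable integrable_of_real int)
        show "integrable P (\<lambda>x. \<bar>\<tau>\<bar> * (ratio x ^ N - ratio x ^ Suc N))"
          by (intro integrable_mult_right Bochner_Integration.integrable_diff int)
        fix x
        define u where "u = ratio x"
        have u: "0 \<le> u" "u \<le> 1" using ratio_bounds by (auto simp: u_def)
        have "of_real (u ^ Suc N) * unit_power \<tau> u - of_real (u ^ Suc N) = of_real (u ^ N) * (of_real u * (unit_power \<tau> u - 1))"
          by (simp add: algebra_simps)
        then have "norm (of_real (u ^ Suc N) * unit_power \<tau> u - of_real (u ^ Suc N)) = u ^ N * (u * norm (unit_power \<tau> u - 1))"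
          using u by (simp only: norm_mult norm_of_real) simp
        also have "\<dots> \<le> u ^ N * (\<bar>\<tau>\<bar> * (1 - u))"
        proof (cases "u = 0")
          case False
          then show ?thesis using u by (intro mult_left_mono norm_unit_power_minus_one_le) auto
        qed simp
        also have "\<dots> = \<bar>\<tau>\<bar> * (u ^ N - u ^ Suc N)" by (simp add: algebra_simps)
        finally show "norm (of_real (ratio x ^ Suc N) * unit_power \<tau> (ratio x) - of_real (ratio x ^ Suc N)) \<le> \<bar>\<tau>\<bar> * (ratio x ^ N - ratio x ^ Suc N)"
          by (simp only: u_def)
      qed
      also have "\<dots> = \<bar>\<tau>\<bar> * (\<mu> N - \<mu> (Suc N))"
        unfolding \<mu>_def by (subst integral_mult_right_zero, subst Bochner_Integration.integral_diff[OF int int]) (rule refl)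
      finally show ?thesis .
    qed
  qed
  then show ?thesis by (simp add: moment_def)
qed

end

end

section \<open>The limit theorem\<close>

text \<open>The triangular form is a product of nonnegative ratios. The sign is what
  \<open>unit_power_mult\<close> asks for.\<close>

lemma det_corr_mat_nonneg:
  assumes "k < n"
  shows "0 \<le> det (corr_mat n k Y)"
proof -
  obtain Q where "triangulates n (Suc k) Q (case_nat (\<lambda>_. 1) Y)"
    using triangulates_exists[of "Suc k" n] assms by (metis Suc_leI)
  from det_corr_mat_triangular[OF assms this] show ?thesis
    by (simp add: prod_nonneg sum_nonneg)
qed

lemma corr_mat_cong: "(\<And>i. i < k \<Longrightarrow> Y i = Z i) \<Longrightarrow> corr_mat n k Y = corr_mat n k Z"
  by (intro eq_matI) (auto simp: corr_mat_def)

lemma det_corr_mat_measurable [measurable]: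
  "(\<lambda>y. det (corr_mat n k y)) \<in> borel_measurable (PiM {..<k} (\<lambda>_. vec_space n))"
proof -
  have comp: "(\<lambda>y. y i j) \<in> borel_measurable (PiM {..<k} (\<lambda>_. vec_space n))" if "i < k" "j < n" for i j
  proof -
    have "(\<lambda>y. y i) \<in> PiM {..<k} (\<lambda>_. vec_space n) \<rightarrow>\<^sub>M vec_space n"
      using that by (intro measurable_component_singleton) auto
    moreover have "(\<lambda>x. x j) \<in> borel_measurable (vec_space n)"
      using that by (intro measurable_component_singleton) auto
    ultimately show ?thesis by (rule measurable_compose)
  qed
  have pm: "(\<lambda>y. pearson n (y i) (y j)) \<in> borel_measurable (PiM {..<k} (\<lambda>_. vec_space n))" if "i < k" "j < k" for i j
    unfolding pearson_def vmean_def
    by (intro borel_measurable_divide borel_measurable_sum borel_measurable_times borel_measurable_diff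
        measurable_compose[OF _ borel_measurable_sqrt] borel_measurable_power borel_measurable_const comp that) auto
  \<comment> \<open>The Leibniz formula makes the determinant a polynomial in measurable
    entries.\<close>
  have "det (corr_mat n k y) = (\<Sum>\<pi>\<in>{\<pi>. \<pi> permutes {0..<k}}. signof \<pi> * (\<Prod>i=0..<k. pearson n (y i) (y (\<pi> i))))" for y
  proof -
    have "corr_mat n k y \<in> carrier_mat k k" by (simp add: corr_mat_def)
    then show ?thesis
      unfolding det_def'[OF \<open>corr_mat n k y \<in> carrier_mat k k\<close>]
      by (intro sum.cong prod.cong refl arg_cong2[where f = "(*)"]) (auto simp: corr_mat_def permutes_in_image)
  qed
  then show ?thesis
    by (simp only:) (intro borel_measurable_sum borel_measurable_times borel_measurable_prod borel_measurable_const pm, auto simp: permutes_in_image)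
qed

section \<open>Characteristic functions of the factors\<close>

context spherical_law
begin

text \<open>\<open>ratio_pos_AE\<close> with all coordinates as \<open>D\<close> shows that the part
  off coordinate 0 does not vanish. After an orthogonal change of coordinates this says that a data
  column is almost surely not constant.\<close>

lemma tail_pos_AE:
  assumes nz: "AE x in P. 0 < sumsq {..<n} x" and n: "2 \<le> n"
  shows "AE x in P. 0 < sumsq {1..<n} x"
proof -
  have "AE x in P. 0 < sumsq_ratio {1..<n} {..<n} x"
    using n by (intro ratio_pos_AE nz) auto
  then show ?thesis
  proof eventually_elim
    case (elim x)
    then have "sumsq {1..<n} x \<noteq> 0" by (auto simp: sumsq_ratio_def)
    then show ?case using sumsq_nonneg[of "{1..<n}" x] by linarith
  qed
qed

text \<open>The characteristic function of log U for the column of index \<open>k\<close>: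
  coordinate 0 belongs to the all-ones vector, coordinates 1, ..., k to the earlier columns.\<close>

definition tail_char :: "real \<Rightarrow> nat \<Rightarrow> complex" where
  "tail_char \<tau> k = (\<integral>x. unit_power \<tau> (sumsq_ratio {Suc k..<n} {1..<n} x) \<partial>P)"

text \<open>At frequency 0 the integrand is the indicator of U \<noteq> 0. The value 1 later shows
  that the determinant is almost surely nonzero.\<close>

lemma tail_char_0:
  assumes nz: "AE x in P. 0 < sumsq {..<n} x" and k: "k + 5 \<le> n"
  shows "tail_char 0 k = 1"
proof -
  have "AE x in P. 0 < sumsq_ratio {Suc k..<n} {1..<n} x"
    using k by (intro ratio_pos_AE tail_pos_AE nz) auto
  then have "AE x in P. unit_power 0 (sumsq_ratio {Suc k..<n} {1..<n} x) = 1"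
    by eventually_elim (simp add: unit_power_def)
  moreover have [measurable]: "sumsq_ratio {Suc k..<n} {1..<n} \<in> borel_measurable (vec_space n)"
    by (intro sumsq_ratio_measurable) auto
  ultimately have "tail_char 0 k = (\<integral>x. 1 \<partial>P)"
    unfolding tail_char_def by (intro integral_cong_AE) measurable
  then show ?thesis by (simp add: prob_space)
qed

lemma tail_char_estimate:
  fixes \<tau> :: real
  assumes nz: "AE x in P. 0 < sumsq {..<n} x" and k: "k + 5 \<le> n" and \<tau>: "4 * \<bar>\<tau>\<bar> \<le> real n - 1 - real k"
  shows "norm (tail_char \<tau> k * exp (log_prim \<tau> ((real n - 1) / 2) - log_prim \<tau> ((real n - 1 - real k) / 2)) - 1)
       \<le> exp (80 * (\<bar>\<tau>\<bar> + \<tau>^2 + \<bar>\<tau>\<bar>^3) / (real n - 1 - real k)^2) - 1"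
proof -
  have c: "real (card {Suc k..<n}) = real n - 1 - real k" "real (card {1..<n}) = real n - 1"
    using k by auto
  have sub: "{1..<n} \<subseteq> {..<n}" "{Suc k..<n} \<subseteq> {1..<n}" and c4: "4 \<le> card {Suc k..<n}" and n2: "2 \<le> n"
    using k by auto
  show ?thesis
    using char_log_ratio_estimate[OF sub tail_pos_AE[OF nz n2] c4, of \<tau>] \<tau>
    unfolding c tail_char_def by blast
qed

end

section \<open>The characteristic function of the log-determinant\<close>

text \<open>By Fubini the last column is integrated first. With the earlier columns fixed,
  \<open>det_corr_mat_step\<close> splits the determinant using a constant \<open>Q\<close>, and
  invariance of the law of the last column removes \<open>Q\<close>; the inner integral leaves a
  factor free of the earlier columns.\<close>

lemma expectation_unit_power_det:
  fixes P :: "nat \<Rightarrow> (nat \<Rightarrow> real) measure"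
  assumes P: "\<And>i. spherical_law (P i) n" and k: "k < n"
  shows "(\<integral>y. unit_power \<tau> (det (corr_mat n k y)) \<partial>PiM {..<k} P) = (\<Prod>i<k. spherical_law.tail_char (P i) n \<tau> i)"
  using k
proof (induction k)
  case 0
  interpret E: product_prob_space P "{}"
    by (rule product_prob_spaceI) (rule spherical_law.axioms(1)[OF P])
  have "det (corr_mat n 0 y) = 1" for y by (simp add: corr_mat_def)
  then show ?case by (simp add: unit_power_def E.P.prob_space)
next
  case (Suc k)
  interpret E: product_prob_space P "{..<Suc k}"
    by (rule product_prob_spaceI) (rule spherical_law.axioms(1)[OF P])
  interpret S: spherical_law "P k" n by (rule P)
  have setsP: "sets (PiM I P) = sets (PiM I (\<lambda>_. vec_space n))" for I
    by (intro sets_PiM_cong refl spherical_law.sets_P[OF P])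
  have "integrable (PiM {..<Suc k} P) (\<lambda>y. unit_power \<tau> (det (corr_mat n (Suc k) y)))"
  proof (rule E.integrable_const_bound[of _ 1])
    show "(\<lambda>y. unit_power \<tau> (det (corr_mat n (Suc k) y))) \<in> borel_measurable (PiM {..<Suc k} P)"
      unfolding measurable_cong_sets[OF setsP refl] by measurable
  qed (simp add: norm_unit_power)
  then have "(\<integral>y. unit_power \<tau> (det (corr_mat n (Suc k) y)) \<partial>PiM {..<Suc k} P)
     = (\<integral>x. (\<integral>y. unit_power \<tau> (det (corr_mat n (Suc k) (x(k := y)))) \<partial>P k) \<partial>PiM {..<k} P)"
    unfolding lessThan_Suc by (intro E.product_integral_insert) auto
  also have "\<dots> = (\<integral>x. unit_power \<tau> (det (corr_mat n k x)) * S.tail_char \<tau> k \<partial>PiM {..<k} P)"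
  proof (intro Bochner_Integration.integral_cong refl)
    fix x
    obtain Q where Q: "orth_nat n Q" "\<And>y. det (corr_mat n (Suc k) (x(k := y))) = det (corr_mat n k x) *
     ((\<Sum>l\<in>{Suc k..<n}. (mat_app n Q y l)^2) / (\<Sum>l\<in>{1..<n}. (mat_app n Q y l)^2))"
      using det_corr_mat_step[OF Suc.prems] by blast
    have "unit_power \<tau> (det (corr_mat n (Suc k) (x(k := y))))
        = unit_power \<tau> (det (corr_mat n k x)) * unit_power \<tau> (sumsq_ratio {Suc k..<n} {1..<n} (mat_app n Q y))" for y
      unfolding Q(2) sumsq_ratio_def sumsq_def
      using Suc.prems by (intro unit_power_mult det_corr_mat_nonneg) (auto simp: sum_nonneg)
    then have "(\<integral>y. unit_power \<tau> (det (corr_mat n (Suc k) (x(k := y)))) \<partial>P k)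
      = unit_power \<tau> (det (corr_mat n k x)) * (\<integral>y. unit_power \<tau> (sumsq_ratio {Suc k..<n} {1..<n} (mat_app n Q y)) \<partial>P k)"
      by simp
    also have "(\<integral>y. unit_power \<tau> (sumsq_ratio {Suc k..<n} {1..<n} (mat_app n Q y)) \<partial>P k) = S.tail_char \<tau> k"
      unfolding S.tail_char_def
    proof (rule S.integral_mat_app[OF Q(1)])
      have [measurable]: "sumsq {Suc k..<n} \<in> borel_measurable (vec_space n)" "sumsq {1..<n} \<in> borel_measurable (vec_space n)"
        by (rule sumsq_measurable; auto)+
      show "(\<lambda>x. unit_power \<tau> (sumsq_ratio {Suc k..<n} {1..<n} x)) \<in> borel_measurable (vec_space n)"
        unfolding sumsq_ratio_def by measurable
    qed
    finally show "(\<integral>y. unit_power \<tau> (det (corr_mat n (Suc k) (x(k := y)))) \<partial>P k)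
       = unit_power \<tau> (det (corr_mat n k x)) * S.tail_char \<tau> k" .
  qed
  also have "\<dots> = (\<Prod>i<k. spherical_law.tail_char (P i) n \<tau> i) * S.tail_char \<tau> k"
    using Suc by simp
  finally show ?case by simp
qed

lemma spherical_law_distr:
  assumes "prob_space M" "spherical M n X"
  shows "spherical_law (distr M (vec_space n) X) n"
proof -
  interpret prob_space M by fact
  have X[measurable]: "X \<in> M \<rightarrow>\<^sub>M vec_space n" using assms by (simp add: spherical_def)
  show ?thesis
  proof (intro spherical_law.intro spherical_law_axioms.intro)
    show "prob_space (distr M (vec_space n) X)" by (rule prob_space_distr) measurable
    show "distr (distr M (vec_space n) X) (vec_space n) (mat_app n Q) = distr M (vec_space n) X" if "orth_nat n Q" for Q
      using assms(2) that by (subst distr_distr) (auto simp: spherical_def o_def)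
  qed simp
qed

lemma log_det_corr_char_estimate:
  fixes Y :: "nat \<Rightarrow> 'a \<Rightarrow> nat \<Rightarrow> real" and n p :: nat
  assumes M: "prob_space M" and p: "0 < p" "p + 5 \<le> n"
    and indep: "prob_space.indep_vars M (\<lambda>_. vec_space n) Y {..<p}"
    and sph: "\<And>i. i < p \<Longrightarrow> spherical M n (Y i)"
    and nonzero: "\<And>i. i < p \<Longrightarrow> measure M {\<omega> \<in> space M. \<forall>k<n. Y i \<omega> k = 0} = 0"
  defines "T \<equiv> \<lambda>\<omega>. (ln (det (corr_mat n p (\<lambda>i. Y i \<omega>))) - mu_n n p) / sqrt (sigma_sq_n n p)"
  shows "real_distribution (distr M borel T)"
    and "\<And>t. sigma_sq_n n p > 0 \<Longrightarrow> \<tau> = t / sqrt (sigma_sq_n n p) \<Longrightarrow> 4 * \<bar>\<tau>\<bar> \<le> real n - 1 - real p \<Longrightarrow>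
      norm (char (distr M borel T) t * exp (of_real (t^2/2)) - 1)
        \<le> exp (90 * (\<bar>\<tau>\<bar> + \<tau>^2 + \<bar>\<tau>\<bar>^3) / (real n - 1 - real p)) - 1"
proof -
  interpret prob_space M by fact
  \<comment> \<open>\<open>expectation_unit_power_det\<close> expects a spherical law at every
    index, so indices from \<open>p\<close> on repeat the law of column 0, which exists as
    \<open>0 < p\<close>.\<close>
  define P where "P = (\<lambda>i. distr M (vec_space n) (Y (if i < p then i else 0)))"
  have P: "spherical_law (P i) n" for i
    unfolding P_def using p by (intro spherical_law_distr M sph) auto
  have Ym: "Y i \<in> M \<rightarrow>\<^sub>M vec_space n" if "i < p" for i
    using sph[OF that] by (simp add: spherical_def)
  have nz: "AE x in P i. 0 < sumsq {..<n} x" for i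
  proof -
    define j where "j = (if i < p then i else 0)"
    have j: "j < p" using p by (simp add: j_def)
    note [measurable] = Ym[OF j]
    have [measurable]: "sumsq {..<n} \<in> borel_measurable (vec_space n)" by (rule sumsq_measurable) simp
    have "{\<omega> \<in> space M. \<not> 0 < sumsq {..<n} (Y j \<omega>)} = {\<omega> \<in> space M. \<forall>k<n. Y j \<omega> k = 0}"
      by (auto simp: sumsq_def not_less sum_nonneg_eq_0_iff order.antisym[OF _ sum_nonneg])
         (metis (no_types, lifting) finite_lessThan lessThan_iff order.antisym sum_nonneg sum_nonneg_eq_0_iff zero_eq_power2 zero_le_power2)
    then have "prob {\<omega> \<in> space M. \<not> 0 < sumsq {..<n} (Y j \<omega>)} = 0" using nonzero[OF j] by simp
    then have "AE \<omega> in M. 0 < sumsq {..<n} (Y j \<omega>)"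
      by (intro AE_I[of _ _ "{\<omega> \<in> space M. \<not> 0 < sumsq {..<n} (Y j \<omega>)}"]) (auto simp: emeasure_eq_measure)
    then show ?thesis unfolding P_def j_def[symmetric]
      by (subst AE_distr_iff) auto
  qed
  have joint: "distr M (PiM {..<p} (\<lambda>_. vec_space n)) (\<lambda>\<omega>. \<lambda>i\<in>{..<p}. Y i \<omega>) = PiM {..<p} P"
  proof -
    have "distr M (PiM {..<p} (\<lambda>_. vec_space n)) (\<lambda>\<omega>. \<lambda>i\<in>{..<p}. Y i \<omega>) = PiM {..<p} (\<lambda>i. distr M (vec_space n) (Y i))"
      using indep p Ym by (subst (asm) indep_vars_iff_distr_eq_PiM') auto
    also have "\<dots> = PiM {..<p} P" by (intro PiM_cong) (auto simp: P_def)
    finally show ?thesis .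
  qed
  define Z where "Z = (\<lambda>\<omega>. det (corr_mat n p (\<lambda>i. Y i \<omega>)))"
  have Ztup: "Z \<omega> = det (corr_mat n p (\<lambda>i\<in>{..<p}. Y i \<omega>))" for \<omega>
    unfolding Z_def by (intro arg_cong[where f = det] corr_mat_cong) auto
  have tup[measurable]: "(\<lambda>\<omega>. \<lambda>i\<in>{..<p}. Y i \<omega>) \<in> M \<rightarrow>\<^sub>M PiM {..<p} (\<lambda>_. vec_space n)"
    using Ym by (intro measurable_restrict) auto
  have Zm[measurable]: "Z \<in> borel_measurable M"
  proof -
    have "Z = (\<lambda>\<omega>. det (corr_mat n p (\<lambda>i\<in>{..<p}. Y i \<omega>)))" by (rule ext) (rule Ztup)
    then show ?thesis by (simp only: measurable_compose[OF tup det_corr_mat_measurable])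
  qed
  have "T = (\<lambda>\<omega>. (ln (Z \<omega>) - mu_n n p) / sqrt (sigma_sq_n n p))" by (simp only: T_def Z_def)
  then have Tm[measurable]: "T \<in> borel_measurable M" by simp
  show "real_distribution (distr M borel T)" by (rule real_distribution_distr) measurable
  have EZ: "(\<integral>\<omega>. unit_power \<tau> (Z \<omega>) \<partial>M) = (\<Prod>i<p. spherical_law.tail_char (P i) n \<tau> i)" for \<tau>
  proof -
    have "(\<integral>\<omega>. unit_power \<tau> (Z \<omega>) \<partial>M) = (\<integral>y. unit_power \<tau> (det (corr_mat n p y)) \<partial>distr M (PiM {..<p} (\<lambda>_. vec_space n)) (\<lambda>\<omega>. \<lambda>i\<in>{..<p}. Y i \<omega>))"
      unfolding Ztup by (subst integral_distr) auto
    also have "\<dots> = (\<Prod>i<p. spherical_law.tail_char (P i) n \<tau> i)"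
      unfolding joint using p by (intro expectation_unit_power_det P) auto
    finally show ?thesis .
  qed
  \<comment> \<open>The product formula at frequency 0 gives P(Z \<noteq> 0) = 1. At Z = 0 the
    default values of \<open>unit_power\<close> and of the exponential of \<open>ln\<close>
    differ.\<close>
  have Z0: "AE \<omega> in M. Z \<omega> \<noteq> 0"
  proof -
    have "(\<integral>\<omega>. unit_power 0 (Z \<omega>) \<partial>M) = 1"
      unfolding EZ using p by (intro prod.neutral ballI spherical_law.tail_char_0[OF P nz]) auto
    moreover have "unit_power 0 u = of_real (if u = 0 then 0 else 1)" for u by (simp add: unit_power_def)
    ultimately have "(\<integral>\<omega>. (if Z \<omega> = 0 then 0 else 1 :: real) \<partial>M) = 1"
      by (simp only: integral_complex_of_real of_real_eq_1_iff)
    moreover have i: "integrable M (\<lambda>\<omega>. if Z \<omega> = 0 then 0 else 1 :: real)"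
      by (rule integrable_const_bound[of _ 1]) auto
    ultimately have "(\<integral>\<omega>. 1 - (if Z \<omega> = 0 then 0 else 1 :: real) \<partial>M) = 0"
      by (subst Bochner_Integration.integral_diff[OF _ i]) (auto simp: prob_space)
    then have "AE \<omega> in M. 1 - (if Z \<omega> = 0 then 0 else 1 :: real) = 0"
      using i by (subst (asm) integral_nonneg_eq_0_iff_AE) auto
    then show ?thesis by eventually_elim (auto split: if_splits)
  qed
  fix t
  assume \<sigma>: "sigma_sq_n n p > 0" and \<tau>: "\<tau> = t / sqrt (sigma_sq_n n p)" "4 * \<bar>\<tau>\<bar> \<le> real n - 1 - real p"
  have "char (distr M borel T) t = (\<integral>\<omega>. iexp (t * T \<omega>) \<partial>M)"
    unfolding char_def by (subst integral_distr) auto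
  also have "\<dots> = (\<integral>\<omega>. exp (- (\<i> * of_real (\<tau> * mu_n n p))) * unit_power \<tau> (Z \<omega>) \<partial>M)"
  proof (rule integral_cong_AE)
    show "AE \<omega> in M. iexp (t * T \<omega>) = exp (- (\<i> * of_real (\<tau> * mu_n n p))) * unit_power \<tau> (Z \<omega>)"
      using Z0
    proof eventually_elim
      case (elim \<omega>)
      have "t * T \<omega> = - (\<tau> * mu_n n p) + \<tau> * ln (Z \<omega>)"
        unfolding T_def Z_def \<tau>(1) by (simp add: diff_divide_distrib right_diff_distrib)
      then have "\<i> * of_real (t * T \<omega>) = - (\<i> * of_real (\<tau> * mu_n n p)) + \<i> * of_real (\<tau> * ln (Z \<omega>))"
        by (simp only: of_real_add of_real_minus distrib_left mult_minus_right)
      then show ?case using elim by (simp only: unit_power_def if_False exp_add)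
    qed
  qed measurable
  also have "\<dots> = exp (- (\<i> * of_real (\<tau> * mu_n n p))) * (\<Prod>i<p. spherical_law.tail_char (P i) n \<tau> i)"
    by (subst integral_mult_right_zero) (simp only: EZ)
  finally have char: "char (distr M borel T) t = exp (- (\<i> * of_real (\<tau> * mu_n n p))) * (\<Prod>i<p. spherical_law.tail_char (P i) n \<tau> i)" .
  \<comment> \<open>The Gaussian factor in \<open>t\<close> becomes the variance term of the target
    exponent in \<open>\<tau>\<close>.\<close>
  have t2: "t^2/2 = \<tau>^2/2 * sigma_sq_n n p" using \<sigma> by (simp add: \<tau>(1) power_divide)
  have "char (distr M borel T) t * exp (of_real (t^2/2))
      = (\<Prod>i<p. spherical_law.tail_char (P i) n \<tau> i) * exp (- (\<i> * of_real (\<tau> * mu_n n p) - of_real (\<tau>^2/2 * sigma_sq_n n p)))"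
  proof -
    have "exp (- (a - b)) = exp (- a) * exp b" for a b :: complex by (simp add: exp_add[symmetric])
    then show ?thesis unfolding char t2 by (simp only: mult_ac)
  qed
  moreover have "norm (\<dots> - 1) \<le> exp (90 * (\<bar>\<tau>\<bar> + \<tau>^2 + \<bar>\<tau>\<bar>^3) / (real n - 1 - real p)) - 1"
  proof (rule prod_beta_estimate[OF p(2)])
    fix i assume i: "i < p"
    show "norm (spherical_law.tail_char (P i) n \<tau> i * exp (log_prim \<tau> ((real n - 1 - real 0) / 2) - log_prim \<tau> ((real n - 1 - real i) / 2)) - 1)
       \<le> exp (80 * (\<bar>\<tau>\<bar> + \<tau>^2 + \<bar>\<tau>\<bar>^3) / (real n - 1 - real i)^2) - 1"
      using spherical_law.tail_char_estimate[OF P[of i] nz[of i], where k = i and \<tau> = \<tau>] i p \<tau>(2) by simp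
  qed
  ultimately show "norm (char (distr M borel T) t * exp (of_real (t^2/2)) - 1)
        \<le> exp (90 * (\<bar>\<tau>\<bar> + \<tau>^2 + \<bar>\<tau>\<bar>^3) / (real n - 1 - real p)) - 1" by simp
qed

section \<open>Convergence in distribution\<close>

theorem theorem6:
  fixes p :: "nat \<Rightarrow> nat" and y :: real
    and M :: "nat \<Rightarrow> 'a measure"
    and Y :: "nat \<Rightarrow> nat \<Rightarrow> 'a \<Rightarrow> nat \<Rightarrow> real"
  assumes dim: "\<forall>\<^sub>F n in sequentially. p n + 5 \<le> n"
    and lim: "(\<lambda>n. real (p n) / real n) \<longlonglongrightarrow> y"
    and y: "0 < y" "y \<le> 1"
    and prob: "\<And>n. prob_space (M n)"
    and indep: "\<And>n. p n + 5 \<le> n \<Longrightarrow>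
        prob_space.indep_vars (M n) (\<lambda>_. vec_space n) (Y n) {..<p n}"
    and sph: "\<And>n i. p n + 5 \<le> n \<Longrightarrow> i < p n \<Longrightarrow> spherical (M n) n (Y n i)"
    and nonzero: "\<And>n i. p n + 5 \<le> n \<Longrightarrow> i < p n \<Longrightarrow>
        measure (M n) {\<omega> \<in> space (M n). \<forall>k<n. Y n i \<omega> k = 0} = 0"
  shows "weak_conv_m
     (\<lambda>n. distr (M n) borel
        (\<lambda>\<omega>. (ln (det (corr_mat n (p n) (\<lambda>i. Y n i \<omega>))) - mu_n n (p n))
              / sqrt (sigma_sq_n n (p n))))
     (density lborel std_normal_density)"
proof -
  define \<nu> where "\<nu> = (\<lambda>n. distr (M n) borel
        (\<lambda>\<omega>. (ln (det (corr_mat n (p n) (\<lambda>i. Y n i \<omega>))) - mu_n n (p n)) / sqrt (sigma_sq_n n (p n))))"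
  define good where "good = (\<lambda>n. 0 < p n \<and> p n + 5 \<le> n)"
  \<comment> \<open>Levy's theorem wants probability measures for every \<open>n\<close>; bad \<open>n\<close> may have junk \<open>distr\<close>.\<close>
  define \<nu>' where "\<nu>' = (\<lambda>n. if good n then \<nu> n else std_normal_distribution)"
  note sa = sigma_asymptotics[OF dim lim y]
  have good: "\<forall>\<^sub>F n in sequentially. good n"
    unfolding good_def using dim sa(3) by eventually_elim simp
  have weak: "weak_conv_m \<nu>' std_normal_distribution"
  proof (rule levy_continuity)
    show "real_distribution (\<nu>' n)" for n
    proof (cases "good n")
      case True
      then show ?thesis
        unfolding \<nu>'_def \<nu>_def good_def
        using log_det_corr_char_estimate(1)[OF prob _ _ indep sph nonzero] by simp
    next
      case False
      then show ?thesis by (simp add: \<nu>'_def real_dist_normal_dist)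
    qed
    show "real_distribution std_normal_distribution" by (rule real_dist_normal_dist)
    fix t
    \<comment> \<open>The frequency varies with \<open>n\<close>; hence the explicit dependence on
      \<tau> in the preceding estimates.\<close>
    define \<tau> where "\<tau> = (\<lambda>n. t / sqrt (sigma_sq_n n (p n)))"
    define b where "b = (\<lambda>n. exp (90 * ((\<bar>\<tau> n\<bar> + (\<tau> n)^2 + \<bar>\<tau> n\<bar>^3) / (real n - 1 - real (p n)))) - 1)"
    have blim: "b \<longlonglongrightarrow> exp (90 * 0) - 1"
      unfolding b_def \<tau>_def by (intro tendsto_intros sa(1))
    have "\<forall>\<^sub>F n in sequentially. norm (char (\<nu>' n) t * exp (of_real (t^2/2)) - 1) \<le> b n"
      using good sa(2) sa(4)[of t]
    proof eventually_elim
      case (elim n)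
      then have g: "0 < p n" "p n + 5 \<le> n" by (auto simp: good_def)
      show ?case
        using log_det_corr_char_estimate(2)[OF prob g indep[OF g(2)] sph[OF g(2)] nonzero[OF g(2)] elim(2) refl, of t] elim
        by (simp add: \<nu>'_def \<nu>_def b_def \<tau>_def)
    qed
    then have "(\<lambda>n. char (\<nu>' n) t * exp (of_real (t^2/2)) - 1) \<longlonglongrightarrow> 0"
      by (rule Lim_null_comparison) (use blim in simp)
    then have "(\<lambda>n. char (\<nu>' n) t * exp (of_real (t^2/2)) * exp (- of_real (t^2/2))) \<longlonglongrightarrow> 1 * exp (- of_real (t^2/2))"
      by (intro tendsto_mult tendsto_const) (simp only: LIM_zero_iff)
    then show "(\<lambda>n. char (\<nu>' n) t) \<longlonglongrightarrow> char std_normal_distribution t"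
      by (simp add: mult.assoc exp_minus_inverse char_std_normal_distribution flip: exp_of_real)
  qed
  \<comment> \<open>Limits of distribution functions ignore finitely many \<open>n\<close>, which
    leads back from \<open>\<nu>'\<close> to \<open>\<nu>\<close>.\<close>
  have eq: "\<forall>\<^sub>F n in sequentially. cdf (\<nu>' n) x = cdf (\<nu> n) x" for x
    using good by eventually_elim (simp add: \<nu>'_def)
  have "weak_conv_m \<nu> std_normal_distribution"
    unfolding weak_conv_m_def weak_conv_def
  proof (intro allI impI)
    fix x assume "isCont (cdf std_normal_distribution) x"
    then have "(\<lambda>n. cdf (\<nu>' n) x) \<longlonglongrightarrow> cdf std_normal_distribution x"
      using weak by (simp add: weak_conv_m_def weak_conv_def)
    then show "(\<lambda>n. cdf (\<nu> n) x) \<longlonglongrightarrow> cdf std_normal_distribution x"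
      by (rule Lim_transform_eventually[OF _ eq])
  qed
  then show ?thesis unfolding \<nu>_def .
qed

end
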